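(* Let $Q$ be a finite additive abelian group and let $\mathfrak{g}$ be a $Q$-graded simple Lie algebra (with minimal grading) over an arbitrary field $\Bbbk$ containing a primitive root of unity of order $|Q|$. Then there exist a subgroup $P\subset Q$ and a simple Lie algebra $\mathfrak{a}$ over $\Bbbk$ with a $Q/P$-grading such that $\mathfrak{g}\simeq\mathfrak{g}(Q,P,\mathfrak{a})$ as $Q$-graded Lie algebras.
   Context: All algebras are over $\Bbbk$ (not necessarily finite-dimensional). A $Q$-graded Lie algebra is a Lie algebra $\mathfrak{g}=\bigoplus_{\alpha\in Q}\mathfrak{g}_\alpha$ with $[\mathfrak{g}_\alpha,\mathfrak{g}_\beta]\subset\mathfrak{g}_{\alpha+\beta}$. It is graded simple if it is not commutative and contains no non-trivial graded ideal (no graded ideal other than $0$ and $\mathfrak{g}$). The grading is minimal if $\{\alpha\in Q:\mathfrak{g}_\alpha\neq0\}$ generates $Q$. Loop algebra: for a subgroup $P\subset Q$ and a simple Lie algebra $\mathfrak{a}=\bigoplus_{\bar\alpha\in Q/P}\mathfrak{a}_{\bar\alpha}$ with a $Q/P$-grading, let $\Bbbk Q$ be the group algebra with basis $\{t^\alpha:\alpha\in Q\}$, $t^\alpha t^\beta=t^{\alpha+\beta}$, and give $\mathfrak{a}\otimes\Bbbk Q$ the bracket $[x\otimes t^\alpha,y\otimes t^\beta]=[x,y]\otimes t^{\alpha+\beta}$. Then $\mathfrak{g}(Q,P,\mathfrak{a}):=\bigoplus_{\alpha\in Q}\mathfrak{a}_{\bar\alpha}\otimes t^\alpha$, where $\bar\alpha=\alpha+P$,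 is a $Q$-graded Lie subalgebra with $\mathfrak{g}(Q,P,\mathfrak{a})_\alpha=\mathfrak{a}_{\bar\alpha}\otimes t^\alpha$. An isomorphism of $Q$-graded Lie algebras means a Lie algebra isomorphism carrying the degree $\alpha$ component onto the degree $\alpha$ component for all $\alpha\in Q$. *)

theory Defs
  imports "HOL-Algebra.Algebra"
begin

section \<open>Lie algebras\<close>

text \<open>A Lie algebra is a record over the library's modules, so it inherits the unused
  ring fields \<open>mult\<close> and \<open>one\<close>. No dimension is fixed: carriers may be infinite-dimensional.\<close>

record ('k, 'a) lie_algebra = "('k, 'a) module" +
  bracket :: "'a \<Rightarrow> 'a \<Rightarrow> 'a"

locale lie_algebra = module K L + K?: field K
  for K :: "('k, 'n) ring_scheme" (structure) and L :: "('k, 'a, 'm) lie_algebra_scheme" (structure) +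
  assumes bracket_closed:
      "\<lbrakk>x \<in> carrier L; y \<in> carrier L\<rbrakk> \<Longrightarrow> bracket L x y \<in> carrier L"
    and bracket_add_left:
      "\<lbrakk>x \<in> carrier L; y \<in> carrier L; z \<in> carrier L\<rbrakk> \<Longrightarrow>
        bracket L (x \<oplus>\<^bsub>L\<^esub> y) z = bracket L x z \<oplus>\<^bsub>L\<^esub> bracket L y z"
    and bracket_add_right:
      "\<lbrakk>x \<in> carrier L; y \<in> carrier L; z \<in> carrier L\<rbrakk> \<Longrightarrow>
        bracket L x (y \<oplus>\<^bsub>L\<^esub> z) = bracket L x y \<oplus>\<^bsub>L\<^esub> bracket L x z"
    and bracket_smult_left:
      "\<lbrakk>c \<in> carrier K; x \<in> carrier L; y \<in> carrier L\<rbrakk> \<Longrightarrow>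
        bracket L (c \<odot>\<^bsub>L\<^esub> x) y = c \<odot>\<^bsub>L\<^esub> bracket L x y"
    and bracket_smult_right:
      "\<lbrakk>c \<in> carrier K; x \<in> carrier L; y \<in> carrier L\<rbrakk> \<Longrightarrow>
        bracket L x (c \<odot>\<^bsub>L\<^esub> y) = c \<odot>\<^bsub>L\<^esub> bracket L x y"
    and bracket_self: "x \<in> carrier L \<Longrightarrow> bracket L x x = \<zero>\<^bsub>L\<^esub>"
    and jacobi:
      "\<lbrakk>x \<in> carrier L; y \<in> carrier L; z \<in> carrier L\<rbrakk> \<Longrightarrow>
        bracket L x (bracket L y z) \<oplus>\<^bsub>L\<^esub> bracket L y (bracket L z x)
          \<oplus>\<^bsub>L\<^esub> bracket L z (bracket L x y) = \<zero>\<^bsub>L\<^esub>"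

definition lie_commutative :: "('k, 'a, 'm) lie_algebra_scheme \<Rightarrow> bool" where
  "lie_commutative L \<longleftrightarrow>
    (\<forall>x \<in> carrier L. \<forall>y \<in> carrier L. bracket L x y = \<zero>\<^bsub>L\<^esub>)"

definition lie_ideal ::
  "'a set \<Rightarrow> ('k, 'n) ring_scheme \<Rightarrow> ('k, 'a, 'm) lie_algebra_scheme \<Rightarrow> bool" where
  "lie_ideal I K L \<longleftrightarrow>
    submodule I K L \<and> (\<forall>x \<in> carrier L. \<forall>y \<in> I. bracket L x y \<in> I)"

definition simple_lie_algebra ::
  "('k, 'n) ring_scheme \<Rightarrow> ('k, 'a, 'm) lie_algebra_scheme \<Rightarrow> bool" where
  "simple_lie_algebra K L \<longleftrightarrow>
    lie_algebra K L \<and> \<not> lie_commutative L \<and>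
    (\<forall>I. lie_ideal I K L \<longrightarrow> I = {\<zero>\<^bsub>L\<^esub>} \<or> I = carrier L)"

section \<open>Gradings\<close>

text \<open>\<open>internal_direct_sum K L A D S\<close> says that \<open>S\<close> is the direct sum of the submodules
  \<open>D \<alpha>\<close>, \<open>\<alpha> \<in> A\<close>. The sum runs over the finite support because \<open>finsum\<close> over an
  infinite index set carries no information.\<close>

definition coeff_support :: "('a, 'm) ring_scheme \<Rightarrow> 'q set \<Rightarrow> ('q \<Rightarrow> 'a) \<Rightarrow> 'q set" where
  "coeff_support L A f = {\<alpha> \<in> A. f \<alpha> \<noteq> \<zero>\<^bsub>L\<^esub>}"

definition internal_direct_sum ::
  "('k, 'n) ring_scheme \<Rightarrow> ('k, 'a, 'm) module_scheme \<Rightarrow> 'q set \<Rightarrow> ('q \<Rightarrow> 'a set) \<Rightarrow> 'a set \<Rightarrow> bool"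
  where
  "internal_direct_sum K L A D S \<longleftrightarrow>
    submodule S K L \<and> (\<forall>\<alpha> \<in> A. submodule (D \<alpha>) K L \<and> D \<alpha> \<subseteq> S) \<and>
    (\<forall>x \<in> S. \<exists>!f. f \<in> (\<Pi>\<^sub>E \<alpha> \<in> A. D \<alpha>) \<and> finite (coeff_support L A f) \<and>
      x = finsum L f (coeff_support L A f))"

text \<open>Grading groups are written multiplicatively, as everywhere in HOL-Algebra; the
  quotient group is the library's \<open>Q Mod P\<close>, whose elements are the cosets \<open>P #> \<alpha>\<close>.\<close>

definition graded_lie_algebra ::
  "('k, 'n) ring_scheme \<Rightarrow> ('q, 'p) monoid_scheme \<Rightarrow> ('k, 'a, 'm) lie_algebra_scheme \<Rightarrow>
    ('q \<Rightarrow> 'a set) \<Rightarrow> bool" where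
  "graded_lie_algebra K Q L D \<longleftrightarrow>
    comm_group Q \<and> lie_algebra K L \<and>
    internal_direct_sum K L (carrier Q) D (carrier L) \<and>
    (\<forall>\<alpha> \<in> carrier Q. \<forall>\<beta> \<in> carrier Q. \<forall>x \<in> D \<alpha>. \<forall>y \<in> D \<beta>.
      bracket L x y \<in> D (\<alpha> \<otimes>\<^bsub>Q\<^esub> \<beta>))"

definition graded_ideal ::
  "'a set \<Rightarrow> ('k, 'n) ring_scheme \<Rightarrow> ('q, 'p) monoid_scheme \<Rightarrow>
    ('k, 'a, 'm) lie_algebra_scheme \<Rightarrow> ('q \<Rightarrow> 'a set) \<Rightarrow> bool" where
  "graded_ideal I K Q L D \<longleftrightarrow>
    lie_ideal I K L \<and> internal_direct_sum K L (carrier Q) (\<lambda>\<alpha>. I \<inter> D \<alpha>) I"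

definition graded_simple ::
  "('k, 'n) ring_scheme \<Rightarrow> ('q, 'p) monoid_scheme \<Rightarrow> ('k, 'a, 'm) lie_algebra_scheme \<Rightarrow>
    ('q \<Rightarrow> 'a set) \<Rightarrow> bool" where
  "graded_simple K Q L D \<longleftrightarrow>
    graded_lie_algebra K Q L D \<and> \<not> lie_commutative L \<and>
    (\<forall>I. graded_ideal I K Q L D \<longrightarrow> I = {\<zero>\<^bsub>L\<^esub>} \<or> I = carrier L)"

definition minimal_grading ::
  "('q, 'p) monoid_scheme \<Rightarrow> ('a, 'm) ring_scheme \<Rightarrow> ('q \<Rightarrow> 'a set) \<Rightarrow> bool" where
  "minimal_grading Q L D \<longleftrightarrow>
    generate Q {\<alpha> \<in> carrier Q. D \<alpha> \<noteq> {\<zero>\<^bsub>L\<^esub>}} = carrier Q"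

definition graded_lie_iso ::
  "('k, 'n) ring_scheme \<Rightarrow> ('q, 'p) monoid_scheme \<Rightarrow>
    ('k, 'a, 'm) lie_algebra_scheme \<Rightarrow> ('q \<Rightarrow> 'a set) \<Rightarrow>
    ('k, 'b, 'l) lie_algebra_scheme \<Rightarrow> ('q \<Rightarrow> 'b set) \<Rightarrow> ('a \<Rightarrow> 'b) set" where
  "graded_lie_iso K Q L D L' D' =
    {\<phi>. bij_betw \<phi> (carrier L) (carrier L') \<and>
      (\<forall>x \<in> carrier L. \<forall>y \<in> carrier L. \<phi> (x \<oplus>\<^bsub>L\<^esub> y) = \<phi> x \<oplus>\<^bsub>L'\<^esub> \<phi> y) \<and>
      (\<forall>c \<in> carrier K. \<forall>x \<in> carrier L. \<phi> (c \<odot>\<^bsub>L\<^esub> x) = c \<odot>\<^bsub>L'\<^esub> \<phi> x) \<and>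
      (\<forall>x \<in> carrier L. \<forall>y \<in> carrier L. \<phi> (bracket L x y) = bracket L' (\<phi> x) (\<phi> y)) \<and>
      (\<forall>\<alpha> \<in> carrier Q. \<phi> ` D \<alpha> = D' \<alpha>)}"

section \<open>Loop algebras\<close>

text \<open>Since the group algebra of \<open>Q\<close> is free on the basis \<open>t\<^sup>\<alpha>\<close>, every element of its tensor
  product with \<open>A\<close> is uniquely a finite sum of terms \<open>x\<^sub>\<alpha> \<otimes> t\<^sup>\<alpha>\<close>. The tensor product is
  modelled by the coefficient functions \<open>\<alpha> \<mapsto> x\<^sub>\<alpha>\<close>, with \<open>x \<otimes> t\<^sup>\<alpha>\<close> being
  \<open>tensor_monomial Q A x \<alpha>\<close>; the bracket is the bilinear extension of the rule
  stated in \<open>bracket_tensor_monomial\<close> below.\<close>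

definition tensor_monomial ::
  "('q, 'p) monoid_scheme \<Rightarrow> ('a, 'm) ring_scheme \<Rightarrow> 'a \<Rightarrow> 'q \<Rightarrow> 'q \<Rightarrow> 'a" where
  "tensor_monomial Q A x \<alpha> = (\<lambda>\<gamma> \<in> carrier Q. if \<gamma> = \<alpha> then x else \<zero>\<^bsub>A\<^esub>)"

definition tensor_group_algebra ::
  "('q, 'p) monoid_scheme \<Rightarrow> ('k, 'a, 'm) lie_algebra_scheme \<Rightarrow> ('k, 'q \<Rightarrow> 'a) lie_algebra" where
  "tensor_group_algebra Q A =
    \<lparr>carrier = {f \<in> carrier Q \<rightarrow>\<^sub>E carrier A. finite (coeff_support A (carrier Q) f)},
     monoid.mult = undefined,
     one = undefined,
     ring.zero = (\<lambda>\<gamma> \<in> carrier Q. \<zero>\<^bsub>A\<^esub>),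
     ring.add = (\<lambda>f g. \<lambda>\<gamma> \<in> carrier Q. f \<gamma> \<oplus>\<^bsub>A\<^esub> g \<gamma>),
     module.smult = (\<lambda>c f. \<lambda>\<gamma> \<in> carrier Q. c \<odot>\<^bsub>A\<^esub> f \<gamma>),
     bracket = (\<lambda>f g. \<lambda>\<gamma> \<in> carrier Q.
       finsum A (\<lambda>(\<alpha>, \<beta>). bracket A (f \<alpha>) (g \<beta>))
         {(\<alpha>, \<beta>). \<alpha> \<in> coeff_support A (carrier Q) f \<and> \<beta> \<in> coeff_support A (carrier Q) g \<and>
           \<alpha> \<otimes>\<^bsub>Q\<^esub> \<beta> = \<gamma>})\<rparr>"

text \<open>\<open>D\<close> is a grading of \<open>A\<close> by \<open>Q Mod P\<close>.\<close>

definition loop_algebra ::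
  "('q, 'p) monoid_scheme \<Rightarrow> 'q set \<Rightarrow> ('k, 'a, 'm) lie_algebra_scheme \<Rightarrow> ('q set \<Rightarrow> 'a set) \<Rightarrow>
    ('k, 'q \<Rightarrow> 'a) lie_algebra" where
  "loop_algebra Q P A D = (tensor_group_algebra Q A)
    \<lparr>carrier := {f \<in> carrier (tensor_group_algebra Q A).
      \<forall>\<alpha> \<in> carrier Q. f \<alpha> \<in> D (P #>\<^bsub>Q\<^esub> \<alpha>)}\<rparr>"

definition loop_component ::
  "('q, 'p) monoid_scheme \<Rightarrow> 'q set \<Rightarrow> ('a, 'm) ring_scheme \<Rightarrow> ('q set \<Rightarrow> 'a set) \<Rightarrow>
    'q \<Rightarrow> ('q \<Rightarrow> 'a) set" where
  "loop_component Q P A D \<alpha> = (\<lambda>x. tensor_monomial Q A x \<alpha>) ` D (P #>\<^bsub>Q\<^esub> \<alpha>)"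

lemma (in lie_algebra) bracket_zero:
  assumes "x \<in> carrier L"
  shows "bracket L \<zero>\<^bsub>L\<^esub> x = \<zero>\<^bsub>L\<^esub>" "bracket L x \<zero>\<^bsub>L\<^esub> = \<zero>\<^bsub>L\<^esub>"
proof -
  have "bracket L (\<zero>\<^bsub>L\<^esub> \<oplus>\<^bsub>L\<^esub> \<zero>\<^bsub>L\<^esub>) x = bracket L \<zero>\<^bsub>L\<^esub> x \<oplus>\<^bsub>L\<^esub> bracket L \<zero>\<^bsub>L\<^esub> x"
    using assms by (intro bracket_add_left) auto
  then show "bracket L \<zero>\<^bsub>L\<^esub> x = \<zero>\<^bsub>L\<^esub>"
    using assms bracket_closed[of "\<zero>\<^bsub>L\<^esub>" x] by (simp add: M.add.r_cancel_one')
  have "bracket L x (\<zero>\<^bsub>L\<^esub> \<oplus>\<^bsub>L\<^esub> \<zero>\<^bsub>L\<^esub>) = bracket L x \<zero>\<^bsub>L\<^esub> \<oplus>\<^bsub>L\<^esub> bracket L x \<zero>\<^bsub>L\<^esub>"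
    using assms by (intro bracket_add_right) auto
  then show "bracket L x \<zero>\<^bsub>L\<^esub> = \<zero>\<^bsub>L\<^esub>"
    using assms bracket_closed[of x "\<zero>\<^bsub>L\<^esub>"] by (simp add: M.add.r_cancel_one')
qed

lemma bracket_tensor_monomial:
  assumes "lie_algebra K A" "comm_group Q"
    and "x \<in> carrier A" "y \<in> carrier A" "\<alpha> \<in> carrier Q" "\<beta> \<in> carrier Q"
  shows "bracket (tensor_group_algebra Q A) (tensor_monomial Q A x \<alpha>) (tensor_monomial Q A y \<beta>)
    = tensor_monomial Q A (bracket A x y) (\<alpha> \<otimes>\<^bsub>Q\<^esub> \<beta>)"
proof -
  interpret A: lie_algebra K A by fact
  interpret Q: comm_group Q by fact
  have supp: "coeff_support A (carrier Q) (tensor_monomial Q A z \<gamma>)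
      = (if z = \<zero>\<^bsub>A\<^esub> then {} else {\<gamma>})"
    if "\<gamma> \<in> carrier Q" for z \<gamma>
    using that by (auto simp: coeff_support_def tensor_monomial_def)
  show ?thesis
  proof (cases "x = \<zero>\<^bsub>A\<^esub> \<or> y = \<zero>\<^bsub>A\<^esub>")
    case True
    then have "bracket A x y = \<zero>\<^bsub>A\<^esub>" using A.bracket_zero assms by auto
    moreover have "{(\<alpha>', \<beta>'). \<alpha>' \<in> coeff_support A (carrier Q) (tensor_monomial Q A x \<alpha>) \<and>
        \<beta>' \<in> coeff_support A (carrier Q) (tensor_monomial Q A y \<beta>) \<and> \<alpha>' \<otimes>\<^bsub>Q\<^esub> \<beta>' = \<gamma>} = {}" for \<gamma>
      using True assms supp by auto
    ultimately show ?thesis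
      by (simp only: tensor_group_algebra_def lie_algebra.simps A.finsum_empty)
        (simp add: tensor_monomial_def restrict_def fun_eq_iff)
  next
    case False
    then have "{(\<alpha>', \<beta>'). \<alpha>' \<in> coeff_support A (carrier Q) (tensor_monomial Q A x \<alpha>) \<and>
        \<beta>' \<in> coeff_support A (carrier Q) (tensor_monomial Q A y \<beta>) \<and> \<alpha>' \<otimes>\<^bsub>Q\<^esub> \<beta>' = \<gamma>} =
        (if \<gamma> = \<alpha> \<otimes>\<^bsub>Q\<^esub> \<beta> then {(\<alpha>, \<beta>)} else {})" for \<gamma>
      using assms supp by auto
    moreover have "tensor_monomial Q A x \<alpha> \<alpha> = x" "tensor_monomial Q A y \<beta> \<beta> = y"
      using assms by (auto simp: tensor_monomial_def)
    ultimately show ?thesis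
      using assms A.bracket_closed[of x y]
      by (simp only: tensor_group_algebra_def lie_algebra.simps)
        (auto simp: tensor_monomial_def[of Q A "bracket A x y"] fun_eq_iff restrict_def)
  qed
qed

end

theory Submission
  imports Defs
begin

text \<open>
  The characters \<open>\<chi> : Q \<rightarrow> K\<^sup>*\<close> act on a \<open>Q\<close>-graded Lie algebra \<open>L\<close> by automorphisms, multiplying
  the component of degree \<open>\<alpha>\<close> by \<open>\<chi> \<alpha>\<close>. Because \<open>K\<close> contains a primitive root of unity of order
  \<open>|Q|\<close>, the characters separate the elements of \<open>Q\<close> (\<open>characters_separate_points\<close>), so gradings can
  be studied through this action: a subspace that is invariant under enough characters is generated by
  its homogeneous elements. The form used throughout is \<open>separated_support_imp_zero\<close>.

  Let \<open>L\<close> be graded simple. The largest graded ideal inside a proper ideal is \<open>0\<close>, so a proper ideal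
  contains no homogeneous element other than \<open>0\<close>. This property survives unions of chains, hence Zorn's
  lemma gives a maximal ideal \<open>I\<close> although \<open>L\<close> may have infinite dimension. As \<open>L\<close> is perfect, the
  quotient \<open>A = L / I\<close> is simple. Let \<open>P\<close> be the annihilator in \<open>Q\<close> of the stabilizer of \<open>I\<close> in
  the character group. The stabilizer acts on \<open>A\<close>, so \<open>A\<close> is graded by \<open>Q / P\<close>, and
  \<open>x \<mapsto> (\<pi> x\<^sub>\<alpha>)\<^sub>\<alpha>\<close>, with \<open>\<pi> : L \<rightarrow> A\<close> the projection, is a homomorphism into the loop algebra. It
  is injective because \<open>I\<close> contains no nonzero homogeneous elements.

  The heart of the matter is surjectivity: the images \<open>\<pi> L\<^sub>\<alpha>\<close> and \<open>\<pi> L\<^sub>\<beta>\<close> must coincide when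
  \<open>\<alpha>\<close> and \<open>\<beta>\<close> lie in the same coset of \<open>P\<close> (\<open>homogeneous_representative\<close>). The translates of
  \<open>I\<close> under the characters are maximal ideals of a perfect Lie algebra, so the Chinese remainder theorem
  holds for them. Given \<open>x\<close> of degree \<open>p \<alpha>\<close> with \<open>p \<in> P\<close>, it yields an element \<open>y\<close> that is
  congruent to a prescribed multiple of \<open>x\<close> modulo each translate. The multiples are chosen such that each
  \<open>\<psi> y\<close> is congruent to \<open>\<psi> \<alpha> y\<close> modulo all translates. The translates intersect in \<open>0\<close>, so
  \<open>y\<close> is a common eigenvector of the characters with the eigenvalues of degree \<open>\<alpha>\<close>, that is, it has
  degree \<open>\<alpha>\<close>; and it is congruent to \<open>x\<close> modulo \<open>I\<close>.
\<close>

section \<open>Finite sums in modules\<close>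

lemma finsum_additive:
  assumes "abelian_group L" "abelian_group M"
    and closed: "\<And>x. x \<in> carrier L \<Longrightarrow> h x \<in> carrier M"
    and add: "\<And>x y. x \<in> carrier L \<Longrightarrow> y \<in> carrier L \<Longrightarrow> h (x \<oplus>\<^bsub>L\<^esub> y) = h x \<oplus>\<^bsub>M\<^esub> h y"
    and f: "\<And>i. i \<in> A \<Longrightarrow> f i \<in> carrier L"
  shows "h (finsum L f A) = finsum M (\<lambda>i. h (f i)) A"
proof -
  interpret L: abelian_group L by fact
  interpret M: abelian_group M by fact
  have "h \<zero>\<^bsub>L\<^esub> = \<zero>\<^bsub>M\<^esub>"
    using add[of "\<zero>\<^bsub>L\<^esub>" "\<zero>\<^bsub>L\<^esub>"] closed[of "\<zero>\<^bsub>L\<^esub>"] by (simp add: M.add.r_cancel_one')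
  then show ?thesis
    using f by (induction A rule: infinite_finite_induct) (simp_all add: Pi_def add closed)
qed

context module
begin

lemma submodule_zero_closed: "submodule I R M \<Longrightarrow> \<zero>\<^bsub>M\<^esub> \<in> I"
  using subgroup.one_closed[of I "add_monoid M"] by (simp add: submodule_def)

lemma submodule_finsum_closed:
  assumes I: "submodule I R M" and f: "\<And>i. i \<in> A \<Longrightarrow> f i \<in> I"
  shows "finsum M f A \<in> I"
proof -
  have sub: "I \<subseteq> carrier M" by (rule submoduleE(1)[OF I])
  show ?thesis
    using f
  proof (induction A rule: infinite_finite_induct)
    case (insert i F)
    then have "f \<in> F \<rightarrow> carrier M" "f i \<in> carrier M" using sub by auto
    then show ?case using insert submoduleE(5)[OF I] by simp
  qed (simp_all add: submodule_zero_closed[OF I])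
qed

text \<open>For a finite index set the supports can be ignored, as the omitted summands are zero.\<close>
lemma internal_direct_sum_finite:
  assumes "finite A"
  shows "internal_direct_sum R M A D S \<longleftrightarrow> submodule S R M \<and>
    (\<forall>\<alpha> \<in> A. submodule (D \<alpha>) R M \<and> D \<alpha> \<subseteq> S) \<and>
    (\<forall>x \<in> S. \<exists>!f. f \<in> (\<Pi>\<^sub>E \<alpha> \<in> A. D \<alpha>) \<and> x = finsum M f A)"
proof -
  have "finsum M f (coeff_support M A f) = finsum M f A"
    if "\<forall>\<alpha> \<in> A. submodule (D \<alpha>) R M" "f \<in> (\<Pi>\<^sub>E \<alpha> \<in> A. D \<alpha>)" for f
  proof -
    have "f \<in> A \<rightarrow> carrier M" using that submoduleE(1) by fast
    then show ?thesis
      using assms by (intro M.add.finprod_mono_neutral_cong_left) (auto simp: coeff_support_def)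
  qed
  moreover have "finite (coeff_support M A f)" for f using assms by (simp add: coeff_support_def)
  ultimately show ?thesis
    unfolding internal_direct_sum_def by (intro conj_cong ball_cong refl) (metis (no_types, lifting))
qed

end

section \<open>Characters of finite abelian groups\<close>

text \<open>One step of the extension of a homomorphism from \<open>H\<close> to a larger group. The only obstruction
  to sending \<open>x\<close> to \<open>w\<close> is that powers of \<open>x\<close> may already lie in \<open>H\<close>.\<close>
lemma extend_hom_by_element:
  fixes Q :: "('q, 'p) monoid_scheme" and G :: "('g, 'r) monoid_scheme"
  assumes "comm_group Q" "comm_group G" "subgroup H Q" "\<chi> \<in> hom (Q\<lparr>carrier := H\<rparr>) G"
    and x: "x \<in> carrier Q" and w: "w \<in> carrier G"
    and compat: "\<And>i::int. x [^]\<^bsub>Q\<^esub> i \<in> H \<Longrightarrow> \<chi> (x [^]\<^bsub>Q\<^esub> i) = w [^]\<^bsub>G\<^esub> i"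
  obtains H' \<psi> where "subgroup H' Q" "H' = {h \<otimes>\<^bsub>Q\<^esub> x [^]\<^bsub>Q\<^esub> i | h (i::int). h \<in> H}"
    "\<psi> \<in> hom (Q\<lparr>carrier := H'\<rparr>) G"
    "\<forall>h \<in> H. \<forall>i::int. \<psi> (h \<otimes>\<^bsub>Q\<^esub> x [^]\<^bsub>Q\<^esub> i) = \<chi> h \<otimes>\<^bsub>G\<^esub> w [^]\<^bsub>G\<^esub> i"
proof -
  interpret Q: comm_group Q by fact
  interpret G: comm_group G by fact
  interpret H: subgroup H Q by fact
  have \<chi>_closed: "\<chi> h \<in> carrier G" if "h \<in> H" for h
    using assms(4) that by (auto simp: hom_def)
  have \<chi>_mult: "\<chi> (h \<otimes>\<^bsub>Q\<^esub> h') = \<chi> h \<otimes>\<^bsub>G\<^esub> \<chi> h'" if "h \<in> H" "h' \<in> H" for h h'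
    using assms(4) that by (auto simp: hom_def)
  define H' where "H' = {h \<otimes>\<^bsub>Q\<^esub> x [^]\<^bsub>Q\<^esub> i | h (i::int). h \<in> H}"
  define \<psi> where "\<psi> q = (THE c. \<exists>h (i::int). h \<in> H \<and> q = h \<otimes>\<^bsub>Q\<^esub> x [^]\<^bsub>Q\<^esub> i \<and>
    c = \<chi> h \<otimes>\<^bsub>G\<^esub> w [^]\<^bsub>G\<^esub> i)" for q
  have well_defined: "\<chi> h \<otimes>\<^bsub>G\<^esub> w [^]\<^bsub>G\<^esub> i = \<chi> h' \<otimes>\<^bsub>G\<^esub> w [^]\<^bsub>G\<^esub> j"
    if h: "h \<in> H" "h' \<in> H" and eq: "h \<otimes>\<^bsub>Q\<^esub> x [^]\<^bsub>Q\<^esub> i = h' \<otimes>\<^bsub>Q\<^esub> x [^]\<^bsub>Q\<^esub> j" for h h' and i j :: int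
  proof -
    have split: "x [^]\<^bsub>Q\<^esub> i = x [^]\<^bsub>Q\<^esub> (i - j) \<otimes>\<^bsub>Q\<^esub> x [^]\<^bsub>Q\<^esub> j"
      "w [^]\<^bsub>G\<^esub> i = w [^]\<^bsub>G\<^esub> (i - j) \<otimes>\<^bsub>G\<^esub> w [^]\<^bsub>G\<^esub> j"
      using x w by (simp_all flip: Q.int_pow_mult G.int_pow_mult)
    have h': "h' = h \<otimes>\<^bsub>Q\<^esub> x [^]\<^bsub>Q\<^esub> (i - j)"
      using eq h x by (simp add: split flip: Q.m_assoc)
    then have "x [^]\<^bsub>Q\<^esub> (i - j) = inv\<^bsub>Q\<^esub> h \<otimes>\<^bsub>Q\<^esub> h'"
      using h x by (simp flip: Q.m_assoc)
    then have in_H: "x [^]\<^bsub>Q\<^esub> (i - j) \<in> H"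
      using h by simp
    have "\<chi> h' = \<chi> h \<otimes>\<^bsub>G\<^esub> w [^]\<^bsub>G\<^esub> (i - j)"
      using h' compat[OF in_H] \<chi>_mult[OF h(1) in_H] by simp
    then show ?thesis
      using h w \<chi>_closed by (simp add: split(2) G.m_assoc)
  qed
  have \<psi>: "\<psi> (h \<otimes>\<^bsub>Q\<^esub> x [^]\<^bsub>Q\<^esub> i) = \<chi> h \<otimes>\<^bsub>G\<^esub> w [^]\<^bsub>G\<^esub> i" if "h \<in> H" for h and i :: int
    unfolding \<psi>_def using that by (intro the_equality) (auto intro: well_defined)
  have mult: "(h \<otimes>\<^bsub>Q\<^esub> x [^]\<^bsub>Q\<^esub> i) \<otimes>\<^bsub>Q\<^esub> (h' \<otimes>\<^bsub>Q\<^esub> x [^]\<^bsub>Q\<^esub> j) = (h \<otimes>\<^bsub>Q\<^esub> h') \<otimes>\<^bsub>Q\<^esub> x [^]\<^bsub>Q\<^esub> (i + j)"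
    if "h \<in> H" "h' \<in> H" for h h' and i j :: int
    using that x by (simp add: Q.m_ac flip: Q.int_pow_mult)
  have "subgroup H' Q"
  proof (rule Q.subgroupI)
    show "H' \<subseteq> carrier Q" using x by (auto simp: H'_def)
    show "H' \<noteq> {}" using H.one_closed unfolding H'_def by blast
    show "inv\<^bsub>Q\<^esub> a \<in> H'" if a: "a \<in> H'" for a
    proof -
      obtain h and i :: int where "h \<in> H" "a = h \<otimes>\<^bsub>Q\<^esub> x [^]\<^bsub>Q\<^esub> i" using a by (auto simp: H'_def)
      then have "inv\<^bsub>Q\<^esub> a = inv\<^bsub>Q\<^esub> h \<otimes>\<^bsub>Q\<^esub> x [^]\<^bsub>Q\<^esub> (- i)" "inv\<^bsub>Q\<^esub> h \<in> H"
        using x by (simp_all add: Q.inv_mult Q.int_pow_neg)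
      then show ?thesis unfolding H'_def by blast
    qed
    show "a \<otimes>\<^bsub>Q\<^esub> b \<in> H'" if a: "a \<in> H'" and b: "b \<in> H'" for a b
    proof -
      obtain h h' and i j :: int where hi: "h \<in> H" "a = h \<otimes>\<^bsub>Q\<^esub> x [^]\<^bsub>Q\<^esub> i"
          "h' \<in> H" "b = h' \<otimes>\<^bsub>Q\<^esub> x [^]\<^bsub>Q\<^esub> j"
        using a b by (auto simp: H'_def)
      have "a \<otimes>\<^bsub>Q\<^esub> b = (h \<otimes>\<^bsub>Q\<^esub> h') \<otimes>\<^bsub>Q\<^esub> x [^]\<^bsub>Q\<^esub> (i + j)" "h \<otimes>\<^bsub>Q\<^esub> h' \<in> H"
        using mult hi by auto
      then show ?thesis unfolding H'_def by blast
    qed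
  qed
  moreover have "\<psi> \<in> hom (Q\<lparr>carrier := H'\<rparr>) G"
  proof (rule homI)
    show "\<psi> a \<in> carrier G" if "a \<in> carrier (Q\<lparr>carrier := H'\<rparr>)" for a
      using that w \<chi>_closed by (auto simp: H'_def \<psi>)
    show "\<psi> (a \<otimes>\<^bsub>Q\<lparr>carrier := H'\<rparr>\<^esub> b) = \<psi> a \<otimes>\<^bsub>G\<^esub> \<psi> b"
      if ab: "a \<in> carrier (Q\<lparr>carrier := H'\<rparr>)" "b \<in> carrier (Q\<lparr>carrier := H'\<rparr>)" for a b
    proof -
      obtain h h' and i j :: int where hi: "h \<in> H" "a = h \<otimes>\<^bsub>Q\<^esub> x [^]\<^bsub>Q\<^esub> i"
          "h' \<in> H" "b = h' \<otimes>\<^bsub>Q\<^esub> x [^]\<^bsub>Q\<^esub> j"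
        using ab by (auto simp: H'_def)
      then show ?thesis
        using w by (simp add: mult \<psi> \<chi>_mult \<chi>_closed G.m_ac flip: G.int_pow_mult)
    qed
  qed
  ultimately show thesis using \<psi> that H'_def by blast
qed

text \<open>A nontrivial character of the cyclic group generated by \<open>a\<close> is extended as far as possible, to
  a subgroup \<open>H\<close>. If \<open>x\<close> were outside \<open>H\<close> and \<open>m > 0\<close> minimal with \<open>x\<^sup>m\<close> in \<open>H\<close>, then the value
  at \<open>x\<^sup>m\<close> would have an \<open>m\<close>-th root, and the character would extend further. The characters are required to take values in
  the powers of \<open>\<zeta>\<close> from the start: this supplies the roots, since \<open>\<zeta>\<^sup>j\<close> is killed by \<open>|Q| / m\<close>
  only if \<open>m\<close> divides \<open>j\<close>.\<close>
lemma characters_separate_points: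
  fixes Q :: "('q, 'p) monoid_scheme" and G :: "('g, 'r) monoid_scheme"
  assumes "comm_group Q" "finite (carrier Q)" "comm_group G"
    and \<zeta>: "\<zeta> \<in> carrier G" "group.ord G \<zeta> = order Q"
    and a: "a \<in> carrier Q" "a \<noteq> \<one>\<^bsub>Q\<^esub>"
  shows "\<exists>\<chi> \<in> hom Q G. \<chi> ` carrier Q \<subseteq> generate G {\<zeta>} \<and> \<chi> a \<noteq> \<one>\<^bsub>G\<^esub>"
proof -
  interpret Q: comm_group Q by fact
  interpret G: comm_group G by fact
  define powers where "powers = range (\<lambda>j::int. \<zeta> [^]\<^bsub>G\<^esub> j)"
  have powers_mult: "c \<otimes>\<^bsub>G\<^esub> d [^]\<^bsub>G\<^esub> (i::int) \<in> powers" if "c \<in> powers" "d \<in> powers" for c d i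
    using that \<zeta>(1) by (auto simp: powers_def G.int_pow_pow simp flip: G.int_pow_mult)
  define good where "good H \<longleftrightarrow> subgroup H Q \<and>
    (\<exists>\<chi>. \<chi> \<in> hom (Q\<lparr>carrier := H\<rparr>) G \<and> \<chi> ` H \<subseteq> powers \<and> a \<in> H \<and> \<chi> a \<noteq> \<one>\<^bsub>G\<^esub>)" for H
  have "finite {H. good H}"
    by (rule finite_subset[of _ "Pow (carrier Q)"])
      (use assms(2) in \<open>auto simp: good_def dest: subgroup.subset\<close>)
  moreover have "{H. good H} \<noteq> {}"
  proof -
    define m where "m = Q.ord a"
    obtain k where k: "order Q = m * k"
      using Q.ord_dvd_group_order[OF a(1)] by (auto simp: m_def)
    have n: "order Q > 0" using assms(2) by (simp add: Q.order_gt_0_iff_finite)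
    have "m \<noteq> 1" using Q.ord_eq_1[OF a(1)] a(2) by (simp add: m_def)
    \<comment> \<open>a primitive root of unity of order \<open>m\<close>, the order of \<open>a\<close>\<close>
    define w where "w = \<zeta> [^]\<^bsub>G\<^esub> int k"
    have w: "w \<in> carrier G" using \<zeta> by (simp add: w_def)
    have "k < order Q" using n k \<open>m \<noteq> 1\<close> by (cases m) auto
    then have "w \<noteq> \<one>\<^bsub>G\<^esub>"
      using \<zeta> n k by (simp add: w_def int_pow_int G.pow_eq_id nat_dvd_not_less)
    have compat: "(\<lambda>_. \<one>\<^bsub>G\<^esub>) (a [^]\<^bsub>Q\<^esub> i) = w [^]\<^bsub>G\<^esub> i" if "a [^]\<^bsub>Q\<^esub> i \<in> {\<one>\<^bsub>Q\<^esub>}" for i :: int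
    proof -
      have "int m dvd i" using that a(1) by (simp add: m_def Q.int_pow_eq_id)
      then have "int (order Q) dvd int k * i" using k by (simp add: mult.commute mult_dvd_mono)
      then have "\<zeta> [^]\<^bsub>G\<^esub> (int k * i) = \<one>\<^bsub>G\<^esub>" using \<zeta> by (simp add: G.int_pow_eq_id)
      then show ?thesis using \<zeta> by (simp add: w_def G.int_pow_pow)
    qed
    have hom: "(\<lambda>_. \<one>\<^bsub>G\<^esub>) \<in> hom (Q\<lparr>carrier := {\<one>\<^bsub>Q\<^esub>}\<rparr>) G" by (auto simp: hom_def)
    obtain H' \<psi> where H': "subgroup H' Q" "H' = {h \<otimes>\<^bsub>Q\<^esub> a [^]\<^bsub>Q\<^esub> i | h (i::int). h \<in> {\<one>\<^bsub>Q\<^esub>}}"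
      "\<psi> \<in> hom (Q\<lparr>carrier := H'\<rparr>) G"
      and \<psi>: "\<forall>h \<in> {\<one>\<^bsub>Q\<^esub>}. \<forall>i::int. \<psi> (h \<otimes>\<^bsub>Q\<^esub> a [^]\<^bsub>Q\<^esub> i) = \<one>\<^bsub>G\<^esub> \<otimes>\<^bsub>G\<^esub> w [^]\<^bsub>G\<^esub> i"
      by (rule extend_hom_by_element[OF assms(1,3) Q.triv_subgroup hom a(1) w compat])
    have "\<psi> a = w" using \<psi>[rule_format, of "\<one>\<^bsub>Q\<^esub>" 1] a w by simp
    moreover have "a \<in> H'" unfolding H'(2) using a by (intro CollectI exI[of _ "\<one>\<^bsub>Q\<^esub>"] exI[of _ 1]) simp
    moreover have "\<one>\<^bsub>G\<^esub> \<in> powers" unfolding powers_def by (rule range_eqI[of _ _ 0]) simp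
    moreover have "w \<in> powers" by (simp add: powers_def w_def)
    ultimately have "good H'"
      unfolding good_def using H'(1,3) \<open>w \<noteq> \<one>\<^bsub>G\<^esub>\<close> \<psi> powers_mult
      by (intro conjI exI[of _ \<psi>]) (auto simp: H'(2))
    then show ?thesis by blast
  qed
  ultimately obtain H where H: "good H" and maximal: "\<And>H'. good H' \<Longrightarrow> H \<subseteq> H' \<Longrightarrow> H' = H"
    using finite_has_maximal[of "{H. good H}"] by auto
  interpret H: subgroup H Q using H by (simp add: good_def)
  obtain \<chi> where \<chi>: "\<chi> \<in> hom (Q\<lparr>carrier := H\<rparr>) G" "\<chi> ` H \<subseteq> powers" "a \<in> H" "\<chi> a \<noteq> \<one>\<^bsub>G\<^esub>"
    using H by (auto simp: good_def)
  interpret QH: group "Q\<lparr>carrier := H\<rparr>" using H.subgroup_is_group Q.is_group by simp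
  interpret \<chi>: group_hom "Q\<lparr>carrier := H\<rparr>" G \<chi> using \<chi>(1) by unfold_locales
  have "H = carrier Q"
  proof (rule ccontr)
    assume "H \<noteq> carrier Q"
    then obtain x where x: "x \<in> carrier Q" "x \<notin> H" using H.subset by blast
    have n: "order Q > 0" "x [^]\<^bsub>Q\<^esub> order Q = \<one>\<^bsub>Q\<^esub>"
      using assms(2) x by (simp_all add: Q.order_gt_0_iff_finite Q.pow_order_eq_1)
    define m where "m = (LEAST m::nat. m > 0 \<and> x [^]\<^bsub>Q\<^esub> m \<in> H)"
    have "\<exists>m::nat. m > 0 \<and> x [^]\<^bsub>Q\<^esub> m \<in> H" using n H.one_closed by metis
    then have m: "m > 0" "x [^]\<^bsub>Q\<^esub> m \<in> H"
      unfolding m_def by (metis (mono_tags, lifting) LeastI)+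
    have m_least: "x [^]\<^bsub>Q\<^esub> i \<notin> H" if "i > 0" "i < m" for i :: nat
      using that not_less_Least unfolding m_def by blast
    have pow_H: "y [^]\<^bsub>Q\<^esub> i \<in> H" if "y \<in> H" for y and i :: int
      using Q.subgroup_int_pow_closed[OF H.subgroup_axioms that] .
    have m_dvd: "int m dvd i" if i: "x [^]\<^bsub>Q\<^esub> i \<in> H" for i :: int
    proof -
      have "x [^]\<^bsub>Q\<^esub> (i mod int m) = x [^]\<^bsub>Q\<^esub> (i - int m * (i div int m))"
        by (simp add: minus_mult_div_eq_mod)
      also have "\<dots> = x [^]\<^bsub>Q\<^esub> i \<otimes>\<^bsub>Q\<^esub> inv\<^bsub>Q\<^esub> ((x [^]\<^bsub>Q\<^esub> m) [^]\<^bsub>Q\<^esub> (i div int m))"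
        using x by (simp add: Q.int_pow_diff Q.int_pow_pow flip: int_pow_int)
      also have "\<dots> \<in> H" using i m pow_H by simp
      finally have "x [^]\<^bsub>Q\<^esub> nat (i mod int m) \<in> H" using m by (simp flip: int_pow_int)
      moreover have "0 \<le> i mod int m" "i mod int m < int m" using m by simp_all
      then have "nat (i mod int m) < m" by linarith
      ultimately have "nat (i mod int m) = 0" using m_least by (meson gr0I)
      then have "i mod int m = 0" using \<open>0 \<le> i mod int m\<close> by linarith
      then show ?thesis by presburger
    qed
    have "int m dvd int (order Q)" using m_dvd[of "int (order Q)"] n H.one_closed by (simp add: int_pow_int)
    then obtain k where k: "order Q = m * k" by auto
    obtain j :: int where j: "\<chi> (x [^]\<^bsub>Q\<^esub> m) = \<zeta> [^]\<^bsub>G\<^esub> j" using m \<chi>(2) by (auto simp: powers_def)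
    have restrict_pow: "y [^]\<^bsub>Q\<lparr>carrier := H\<rparr>\<^esub> i = y [^]\<^bsub>Q\<^esub> i" if "y \<in> H" for y and i :: int
      using Q.int_pow_consistent[OF H.subgroup_axioms that] by simp
    have \<chi>_pow: "\<chi> ((x [^]\<^bsub>Q\<^esub> m) [^]\<^bsub>Q\<^esub> i) = \<zeta> [^]\<^bsub>G\<^esub> (j * i)" for i :: int
      using \<chi>.hom_int_pow[of "x [^]\<^bsub>Q\<^esub> m" i] m j \<zeta> restrict_pow by (simp add: G.int_pow_pow)
    have "(x [^]\<^bsub>Q\<^esub> m) [^]\<^bsub>Q\<^esub> int k = \<one>\<^bsub>Q\<^esub>" using n k x by (simp add: int_pow_int Q.nat_pow_pow)
    then have "\<zeta> [^]\<^bsub>G\<^esub> (j * int k) = \<one>\<^bsub>G\<^esub>" using \<chi>_pow[of "int k"] \<chi>.hom_one by simp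
    then have "int (order Q) dvd j * int k" using \<zeta> G.int_pow_eq_id by metis
    then have "int m dvd j" using k n by auto
    then obtain l where l: "j = int m * l" by auto
    \<comment> \<open>an \<open>m\<close>-th root of the value of \<open>\<chi>\<close> at \<open>x\<^sup>m\<close>\<close>
    define w where "w = \<zeta> [^]\<^bsub>G\<^esub> l"
    have w: "w \<in> carrier G" "w \<in> powers" using \<zeta> by (auto simp: w_def powers_def)
    have compat: "\<chi> (x [^]\<^bsub>Q\<^esub> i) = w [^]\<^bsub>G\<^esub> i" if i: "x [^]\<^bsub>Q\<^esub> i \<in> H" for i :: int
    proof -
      obtain i' where i': "i = int m * i'" using m_dvd[OF i] by auto
      then have "\<chi> (x [^]\<^bsub>Q\<^esub> i) = \<zeta> [^]\<^bsub>G\<^esub> (j * i')"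
        using \<chi>_pow[of i'] x by (simp add: Q.int_pow_pow flip: int_pow_int)
      then show ?thesis using \<zeta> by (simp add: w_def i' l G.int_pow_pow ac_simps)
    qed
    obtain H' \<psi> where H': "subgroup H' Q" "H' = {h \<otimes>\<^bsub>Q\<^esub> x [^]\<^bsub>Q\<^esub> i | h (i::int). h \<in> H}"
      "\<psi> \<in> hom (Q\<lparr>carrier := H'\<rparr>) G"
      and \<psi>: "\<forall>h \<in> H. \<forall>i::int. \<psi> (h \<otimes>\<^bsub>Q\<^esub> x [^]\<^bsub>Q\<^esub> i) = \<chi> h \<otimes>\<^bsub>G\<^esub> w [^]\<^bsub>G\<^esub> i"
      by (rule extend_hom_by_element[OF assms(1,3) H.subgroup_axioms \<chi>(1) x(1) w(1) compat])
    have extends: "h \<in> H' \<and> \<psi> h = \<chi> h" if "h \<in> H" for h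
    proof
      show "h \<in> H'" unfolding H'(2) using that
        by (intro CollectI exI[of _ h] exI[of _ 0]) simp
      show "\<psi> h = \<chi> h" using \<psi>[rule_format, OF that, of 0] that \<chi>.hom_closed[of h] by simp
    qed
    have "x \<in> H'" unfolding H'(2) using x
      by (intro CollectI exI[of _ "\<one>\<^bsub>Q\<^esub>"] exI[of _ 1]) simp
    have "\<psi> ` H' \<subseteq> powers" using \<psi> powers_mult w \<chi>(2) by (auto simp: H'(2))
    then have "good H'" unfolding good_def using H'(1,3) extends \<chi>(3,4) by auto
    then show False using maximal[of H'] extends \<open>x \<in> H'\<close> x by blast
  qed
  moreover have "powers = generate G {\<zeta>}" using G.generate_pow[OF \<zeta>(1)] by (auto simp: powers_def)
  ultimately show ?thesis using \<chi> by auto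
qed

text \<open>Characters are total functions whose values outside \<open>carrier Q\<close> carry no information, so the
  group laws are required only up to agreement on \<open>carrier Q\<close>.\<close>
definition separating_character_group ::
  "('q, 'p) monoid_scheme \<Rightarrow> ('g, 'r) monoid_scheme \<Rightarrow> ('q \<Rightarrow> 'g) set \<Rightarrow> bool" where
  "separating_character_group Q G \<Xi> \<longleftrightarrow> finite \<Xi> \<and> \<Xi> \<subseteq> hom Q G \<and>
    (\<exists>\<epsilon> \<in> \<Xi>. \<forall>\<alpha> \<in> carrier Q. \<epsilon> \<alpha> = \<one>\<^bsub>G\<^esub>) \<and>
    (\<forall>\<chi> \<in> \<Xi>. \<forall>\<psi> \<in> \<Xi>. \<exists>\<theta> \<in> \<Xi>. \<forall>\<alpha> \<in> carrier Q. \<theta> \<alpha> = \<chi> \<alpha> \<otimes>\<^bsub>G\<^esub> \<psi> \<alpha>) \<and>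
    (\<forall>\<chi> \<in> \<Xi>. \<exists>\<psi> \<in> \<Xi>. \<forall>\<alpha> \<in> carrier Q. \<chi> \<alpha> \<otimes>\<^bsub>G\<^esub> \<psi> \<alpha> = \<one>\<^bsub>G\<^esub>) \<and>
    (\<forall>\<alpha> \<in> carrier Q. \<forall>\<beta> \<in> carrier Q. \<alpha> \<noteq> \<beta> \<longrightarrow> (\<exists>\<chi> \<in> \<Xi>. \<chi> \<alpha> \<noteq> \<chi> \<beta>))"

lemma exists_separating_character_group:
  fixes Q :: "('q, 'p) monoid_scheme" and G :: "('g, 'r) monoid_scheme"
  assumes "comm_group Q" "finite (carrier Q)" "comm_group G"
    and \<zeta>: "\<zeta> \<in> carrier G" "group.ord G \<zeta> = order Q"
  shows "\<exists>\<Xi>. separating_character_group Q G \<Xi>"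
proof -
  interpret Q: comm_group Q by fact
  interpret G: comm_group G by fact
  let ?\<mu> = "generate G {\<zeta>}"
  interpret \<mu>: subgroup ?\<mu> G using \<zeta> by (intro G.generate_is_subgroup) simp
  define \<Xi> where "\<Xi> = {\<chi> \<in> hom Q G. \<chi> \<in> carrier Q \<rightarrow>\<^sub>E ?\<mu>}"
  have "card ?\<mu> > 0"
    using G.generate_pow_card[OF \<zeta>(1)] \<zeta>(2) assms(2) Q.order_gt_0_iff_finite by simp
  then have "finite ?\<mu>" by (rule card_ge_0_finite)
  then have "finite \<Xi>"
    by (intro finite_subset[OF _ finite_PiE[OF assms(2), of "\<lambda>_. ?\<mu>"]]) (auto simp: \<Xi>_def)
  moreover have in_\<Xi>: "restrict \<chi> (carrier Q) \<in> \<Xi>" if "\<chi> \<in> hom Q G" "\<chi> ` carrier Q \<subseteq> ?\<mu>" for \<chi>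
    using that by (auto simp: \<Xi>_def hom_def)
  have mem: "\<chi> \<alpha> \<in> ?\<mu>" "\<chi> \<alpha> \<in> carrier G" if "\<chi> \<in> \<Xi>" "\<alpha> \<in> carrier Q" for \<chi> \<alpha>
    using that \<mu>.subset by (auto simp: \<Xi>_def)
  have mult: "\<chi> (\<alpha> \<otimes>\<^bsub>Q\<^esub> \<beta>) = \<chi> \<alpha> \<otimes>\<^bsub>G\<^esub> \<chi> \<beta>" if "\<chi> \<in> \<Xi>" "\<alpha> \<in> carrier Q" "\<beta> \<in> carrier Q" for \<chi> \<alpha> \<beta>
    using that by (auto simp: \<Xi>_def hom_mult)
  have "\<exists>\<epsilon> \<in> \<Xi>. \<forall>\<alpha> \<in> carrier Q. \<epsilon> \<alpha> = \<one>\<^bsub>G\<^esub>"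
    using \<mu>.one_closed by (intro bexI[OF _ in_\<Xi>[of "\<lambda>_. \<one>\<^bsub>G\<^esub>"]]) (auto simp: hom_def)
  moreover have "\<exists>\<theta> \<in> \<Xi>. \<forall>\<alpha> \<in> carrier Q. \<theta> \<alpha> = \<chi> \<alpha> \<otimes>\<^bsub>G\<^esub> \<psi> \<alpha>" if "\<chi> \<in> \<Xi>" "\<psi> \<in> \<Xi>" for \<chi> \<psi>
    using mem[OF that(1)] mem[OF that(2)] mult[OF that(1)] mult[OF that(2)]
    by (intro bexI[OF _ in_\<Xi>[of "\<lambda>\<alpha>. \<chi> \<alpha> \<otimes>\<^bsub>G\<^esub> \<psi> \<alpha>"]]) (auto intro!: homI simp: G.m_ac)
  moreover have "\<exists>\<psi> \<in> \<Xi>. \<forall>\<alpha> \<in> carrier Q. \<chi> \<alpha> \<otimes>\<^bsub>G\<^esub> \<psi> \<alpha> = \<one>\<^bsub>G\<^esub>" if "\<chi> \<in> \<Xi>" for \<chi>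
    using mem[OF that] mult[OF that]
    by (intro bexI[OF _ in_\<Xi>[of "\<lambda>\<alpha>. inv\<^bsub>G\<^esub> \<chi> \<alpha>"]]) (auto intro!: homI simp: G.inv_mult)
  moreover have "\<exists>\<chi> \<in> \<Xi>. \<chi> \<alpha> \<noteq> \<chi> \<beta>" if \<alpha>\<beta>: "\<alpha> \<in> carrier Q" "\<beta> \<in> carrier Q" "\<alpha> \<noteq> \<beta>" for \<alpha> \<beta>
  proof -
    define \<gamma> where "\<gamma> = \<alpha> \<otimes>\<^bsub>Q\<^esub> inv\<^bsub>Q\<^esub> \<beta>"
    have \<gamma>: "\<gamma> \<in> carrier Q" "\<alpha> = \<gamma> \<otimes>\<^bsub>Q\<^esub> \<beta>" using \<alpha>\<beta> by (simp_all add: \<gamma>_def Q.m_assoc)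
    then have "\<gamma> \<noteq> \<one>\<^bsub>Q\<^esub>" using \<alpha>\<beta> by auto
    then obtain \<chi> where \<chi>: "\<chi> \<in> hom Q G" "\<chi> ` carrier Q \<subseteq> ?\<mu>" "\<chi> \<gamma> \<noteq> \<one>\<^bsub>G\<^esub>"
      using characters_separate_points[OF assms \<gamma>(1)] by blast
    then have "\<chi> \<alpha> = \<chi> \<gamma> \<otimes>\<^bsub>G\<^esub> \<chi> \<beta>" "\<chi> \<gamma> \<in> carrier G" "\<chi> \<beta> \<in> carrier G"
      using \<alpha>\<beta>(2) \<gamma> by (simp_all add: hom_mult hom_in_carrier)
    then have "\<chi> \<alpha> \<noteq> \<chi> \<beta>" using \<chi>(3) by simp
    then show ?thesis using \<alpha>\<beta> in_\<Xi>[OF \<chi>(1,2)] by (intro bexI[of _ "restrict \<chi> (carrier Q)"]) auto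
  qed
  moreover have "\<Xi> \<subseteq> hom Q G" by (auto simp: \<Xi>_def)
  ultimately have "separating_character_group Q G \<Xi>" by (simp add: separating_character_group_def)
  then show ?thesis by blast
qed

section \<open>Ideals of Lie algebras\<close>

context lie_algebra
begin

lemma minus_smult: "x \<in> carrier L \<Longrightarrow> \<ominus>\<^bsub>L\<^esub> x = (\<ominus> \<one>) \<odot>\<^bsub>L\<^esub> x"
  by (simp add: smult_l_minus)

lemma add_diff_cancel: "x \<in> carrier L \<Longrightarrow> y \<in> carrier L \<Longrightarrow> y \<oplus>\<^bsub>L\<^esub> (x \<ominus>\<^bsub>L\<^esub> y) = x"
  by (simp add: a_minus_def M.a_lcomm M.r_neg)

lemma diff_eq_zero_iff: "x \<in> carrier L \<Longrightarrow> y \<in> carrier L \<Longrightarrow> x \<ominus>\<^bsub>L\<^esub> y = \<zero>\<^bsub>L\<^esub> \<longleftrightarrow> x = y"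
  using add_diff_cancel[of x y] by (auto simp: a_minus_def M.r_neg)

lemma smult_eq_zeroD:
  assumes "c \<in> carrier K" "x \<in> carrier L" "c \<odot>\<^bsub>L\<^esub> x = \<zero>\<^bsub>L\<^esub>" "c \<noteq> \<zero>"
  shows "x = \<zero>\<^bsub>L\<^esub>"
proof -
  have c: "inv c \<in> carrier K" "inv c \<otimes> c = \<one>" using assms field_Units by auto
  then have "x = inv c \<odot>\<^bsub>L\<^esub> (c \<odot>\<^bsub>L\<^esub> x)" using assms(1,2) by (simp flip: smult_assoc1)
  then show ?thesis using assms(3) c by simp
qed

lemma smult_eq_imp_zero:
  assumes "c \<in> carrier K" "d \<in> carrier K" "x \<in> carrier L" "c \<odot>\<^bsub>L\<^esub> x = d \<odot>\<^bsub>L\<^esub> x" "c \<noteq> d"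
  shows "x = \<zero>\<^bsub>L\<^esub>"
proof (rule smult_eq_zeroD)
  show "(c \<ominus> d) \<odot>\<^bsub>L\<^esub> x = \<zero>\<^bsub>L\<^esub>"
    using assms(1-4) by (simp add: R.minus_eq smult_l_distr smult_l_minus M.r_neg)
  show "c \<ominus> d \<noteq> \<zero>" using assms by simp
qed (use assms in simp_all)

lemma bracket_skew:
  assumes "x \<in> carrier L" "y \<in> carrier L"
  shows "bracket L x y = \<ominus>\<^bsub>L\<^esub> bracket L y x"
proof -
  have "\<zero>\<^bsub>L\<^esub> = bracket L (x \<oplus>\<^bsub>L\<^esub> y) (x \<oplus>\<^bsub>L\<^esub> y)"
    using assms by (simp add: bracket_self)
  also have "\<dots> = bracket L x (x \<oplus>\<^bsub>L\<^esub> y) \<oplus>\<^bsub>L\<^esub> bracket L y (x \<oplus>\<^bsub>L\<^esub> y)"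
    using assms by (intro bracket_add_left) simp_all
  also have "\<dots> = bracket L x y \<oplus>\<^bsub>L\<^esub> bracket L y x"
    using assms by (simp add: bracket_add_right bracket_closed bracket_self)
  finally have "bracket L x y \<oplus>\<^bsub>L\<^esub> bracket L y x = \<zero>\<^bsub>L\<^esub>" by simp
  then show ?thesis
    using assms bracket_closed M.minus_equality[of "bracket L x y" "bracket L y x"] by simp
qed

lemma lie_idealI:
  assumes "I \<subseteq> carrier L" "\<zero>\<^bsub>L\<^esub> \<in> I"
    and "\<And>x y. x \<in> I \<Longrightarrow> y \<in> I \<Longrightarrow> x \<oplus>\<^bsub>L\<^esub> y \<in> I"
    and smult: "\<And>c x. c \<in> carrier K \<Longrightarrow> x \<in> I \<Longrightarrow> c \<odot>\<^bsub>L\<^esub> x \<in> I"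
    and "\<And>x y. x \<in> carrier L \<Longrightarrow> y \<in> I \<Longrightarrow> bracket L x y \<in> I"
  shows "lie_ideal I K L"
proof -
  have "\<ominus>\<^bsub>L\<^esub> x \<in> I" if "x \<in> I" for x
    using smult[of "\<ominus> \<one>" x] that assms(1) by (auto simp: minus_smult)
  then show ?thesis
    unfolding lie_ideal_def using assms by (auto intro!: submoduleI)
qed

lemma submodule_minus_closed: "submodule I K L \<Longrightarrow> x \<in> I \<Longrightarrow> y \<in> I \<Longrightarrow> x \<ominus>\<^bsub>L\<^esub> y \<in> I"
  by (simp add: a_minus_def submoduleE(3,5))

lemma
  assumes "lie_ideal I K L"
  shows lie_ideal_submodule: "submodule I K L"
    and lie_ideal_carrier: "x \<in> I \<Longrightarrow> x \<in> carrier L"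
    and lie_ideal_zero: "\<zero>\<^bsub>L\<^esub> \<in> I"
    and lie_ideal_add: "x \<in> I \<Longrightarrow> y \<in> I \<Longrightarrow> x \<oplus>\<^bsub>L\<^esub> y \<in> I"
    and lie_ideal_uminus: "x \<in> I \<Longrightarrow> \<ominus>\<^bsub>L\<^esub> x \<in> I"
    and lie_ideal_minus: "x \<in> I \<Longrightarrow> y \<in> I \<Longrightarrow> x \<ominus>\<^bsub>L\<^esub> y \<in> I"
    and lie_ideal_smult: "c \<in> carrier K \<Longrightarrow> x \<in> I \<Longrightarrow> c \<odot>\<^bsub>L\<^esub> x \<in> I"
    and lie_ideal_bracket: "x \<in> carrier L \<Longrightarrow> y \<in> I \<Longrightarrow> bracket L x y \<in> I"
    and lie_ideal_bracket': "x \<in> I \<Longrightarrow> y \<in> carrier L \<Longrightarrow> bracket L x y \<in> I"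
proof -
  show sub: "submodule I K L" using assms by (simp add: lie_ideal_def)
  show carrier: "x \<in> carrier L" if "x \<in> I" for x using submoduleE(1)[OF sub] that by blast
  show "\<zero>\<^bsub>L\<^esub> \<in> I" by (rule submodule_zero_closed[OF sub])
  show "x \<in> I \<Longrightarrow> y \<in> I \<Longrightarrow> x \<oplus>\<^bsub>L\<^esub> y \<in> I" by (rule submoduleE(5)[OF sub])
  show uminus: "\<ominus>\<^bsub>L\<^esub> x \<in> I" if "x \<in> I" for x using submoduleE(3)[OF sub] that .
  show "x \<in> I \<Longrightarrow> y \<in> I \<Longrightarrow> x \<ominus>\<^bsub>L\<^esub> y \<in> I" by (rule submodule_minus_closed[OF sub])
  show "c \<in> carrier K \<Longrightarrow> x \<in> I \<Longrightarrow> c \<odot>\<^bsub>L\<^esub> x \<in> I" by (rule submoduleE(4)[OF sub])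
  show bracket: "bracket L x y \<in> I" if "x \<in> carrier L" "y \<in> I" for x y
    using assms that by (simp add: lie_ideal_def)
  show "bracket L x y \<in> I" if "x \<in> I" "y \<in> carrier L"
    using bracket_skew[of x y] bracket[of y x] uminus carrier that by simp
qed

lemma set_addI: "a \<in> A \<Longrightarrow> b \<in> B \<Longrightarrow> a \<oplus>\<^bsub>L\<^esub> b \<in> A <+>\<^bsub>L\<^esub> B"
  unfolding set_add_def' by blast

text \<open>The sum of ideals is used for the comaximality argument in the Chinese remainder theorem.\<close>
lemma lie_ideal_sum:
  assumes A: "lie_ideal A K L" and B: "lie_ideal B K L"
  shows "lie_ideal (A <+>\<^bsub>L\<^esub> B) K L"
proof (rule lie_idealI)
  note c = lie_ideal_carrier[OF A] lie_ideal_carrier[OF B]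
  show "A <+>\<^bsub>L\<^esub> B \<subseteq> carrier L" using c by (auto simp: set_add_def')
  show "\<zero>\<^bsub>L\<^esub> \<in> A <+>\<^bsub>L\<^esub> B"
    using set_addI[OF lie_ideal_zero[OF A] lie_ideal_zero[OF B]] by simp
  show "x \<oplus>\<^bsub>L\<^esub> y \<in> A <+>\<^bsub>L\<^esub> B" if x: "x \<in> A <+>\<^bsub>L\<^esub> B" and y: "y \<in> A <+>\<^bsub>L\<^esub> B" for x y
  proof -
    obtain a b a' b' where ab: "a \<in> A" "b \<in> B" "a' \<in> A" "b' \<in> B" "x = a \<oplus>\<^bsub>L\<^esub> b" "y = a' \<oplus>\<^bsub>L\<^esub> b'"
      using x y by (auto simp: set_add_def')
    then have "x \<oplus>\<^bsub>L\<^esub> y = (a \<oplus>\<^bsub>L\<^esub> a') \<oplus>\<^bsub>L\<^esub> (b \<oplus>\<^bsub>L\<^esub> b')" using c by (simp add: M.a_ac)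
    then show ?thesis using ab by (auto intro!: set_addI lie_ideal_add[OF A] lie_ideal_add[OF B])
  qed
  show "s \<odot>\<^bsub>L\<^esub> x \<in> A <+>\<^bsub>L\<^esub> B" if s: "s \<in> carrier K" and x: "x \<in> A <+>\<^bsub>L\<^esub> B" for s x
  proof -
    obtain a b where ab: "a \<in> A" "b \<in> B" "x = a \<oplus>\<^bsub>L\<^esub> b" using x by (auto simp: set_add_def')
    then have "s \<odot>\<^bsub>L\<^esub> x = s \<odot>\<^bsub>L\<^esub> a \<oplus>\<^bsub>L\<^esub> s \<odot>\<^bsub>L\<^esub> b" using c s by (simp add: smult_r_distr)
    then show ?thesis using ab s by (auto intro!: set_addI lie_ideal_smult[OF A] lie_ideal_smult[OF B])
  qed
  show "bracket L s x \<in> A <+>\<^bsub>L\<^esub> B" if s: "s \<in> carrier L" and x: "x \<in> A <+>\<^bsub>L\<^esub> B" for s x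
  proof -
    obtain a b where ab: "a \<in> A" "b \<in> B" "x = a \<oplus>\<^bsub>L\<^esub> b" using x by (auto simp: set_add_def')
    then have "bracket L s x = bracket L s a \<oplus>\<^bsub>L\<^esub> bracket L s b" using c s by (simp add: bracket_add_right)
    then show ?thesis using ab s by (auto intro!: set_addI lie_ideal_bracket[OF A] lie_ideal_bracket[OF B])
  qed
qed

lemma subset_lie_ideal_sum:
  assumes A: "lie_ideal A K L" and B: "lie_ideal B K L"
  shows "A \<subseteq> A <+>\<^bsub>L\<^esub> B" "B \<subseteq> A <+>\<^bsub>L\<^esub> B"
proof -
  show "A \<subseteq> A <+>\<^bsub>L\<^esub> B"
    using set_addI[OF _ lie_ideal_zero[OF B]] lie_ideal_carrier[OF A] by fastforce
  show "B \<subseteq> A <+>\<^bsub>L\<^esub> B"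
    using set_addI[OF lie_ideal_zero[OF A]] lie_ideal_carrier[OF B] by fastforce
qed

lemma lie_ideal_Inter:
  assumes "\<And>i. i \<in> F \<Longrightarrow> lie_ideal (A i) K L"
  shows "lie_ideal {x \<in> carrier L. \<forall>i \<in> F. x \<in> A i} K L"
  by (rule lie_idealI)
    (use assms in \<open>auto intro: lie_ideal_zero lie_ideal_add lie_ideal_smult lie_ideal_bracket bracket_closed\<close>)

end

definition maximal_lie_ideal ::
  "'a set \<Rightarrow> ('k, 'n) ring_scheme \<Rightarrow> ('k, 'a, 'm) lie_algebra_scheme \<Rightarrow> bool" where
  "maximal_lie_ideal M K L \<longleftrightarrow> lie_ideal M K L \<and> M \<noteq> carrier L \<and>
    (\<forall>J. lie_ideal J K L \<longrightarrow> M \<subseteq> J \<longrightarrow> J = M \<or> J = carrier L)"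

text \<open>This says \<open>[L, L] = L\<close> without forming \<open>[L, L]\<close>: a proper ideal never contains all brackets.\<close>
definition perfect_lie_algebra ::
  "('k, 'n) ring_scheme \<Rightarrow> ('k, 'a, 'm) lie_algebra_scheme \<Rightarrow> bool" where
  "perfect_lie_algebra K L \<longleftrightarrow> (\<forall>J. lie_ideal J K L \<longrightarrow>
    (\<forall>x \<in> carrier L. \<forall>y \<in> carrier L. bracket L x y \<in> J) \<longrightarrow> J = carrier L)"

context lie_algebra
begin

lemma maximal_lie_ideal_sum_eq_carrier:
  assumes M: "maximal_lie_ideal M K L" and A: "lie_ideal A K L" "\<not> A \<subseteq> M"
  shows "A <+>\<^bsub>L\<^esub> M = carrier L"
proof -
  have M': "lie_ideal M K L" using M by (simp add: maximal_lie_ideal_def)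
  have "A <+>\<^bsub>L\<^esub> M \<noteq> M" using subset_lie_ideal_sum(1)[OF A(1) M'] A(2) by blast
  then show ?thesis
    using M lie_ideal_sum[OF A(1) M'] subset_lie_ideal_sum(2)[OF A(1) M']
    by (auto simp: maximal_lie_ideal_def)
qed

text \<open>If neither \<open>A\<close> nor \<open>B\<close> is contained in \<open>M\<close>, then \<open>L = A + M = B + M\<close>, and expanding brackets
  puts \<open>[L, L]\<close> into \<open>[A, B] + M\<close>. Perfectness rules out \<open>[A, B] \<subseteq> M\<close>.\<close>
lemma maximal_lie_ideal_prime:
  assumes perfect: "perfect_lie_algebra K L" and M: "maximal_lie_ideal M K L"
    and A: "lie_ideal A K L" and B: "lie_ideal B K L"
    and AB: "\<And>a b. a \<in> A \<Longrightarrow> b \<in> B \<Longrightarrow> bracket L a b \<in> M"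
  shows "A \<subseteq> M \<or> B \<subseteq> M"
proof (rule ccontr)
  assume "\<not> (A \<subseteq> M \<or> B \<subseteq> M)"
  then have sum: "A <+>\<^bsub>L\<^esub> M = carrier L" "B <+>\<^bsub>L\<^esub> M = carrier L"
    using maximal_lie_ideal_sum_eq_carrier M A B by auto
  have M': "lie_ideal M K L" using M by (simp add: maximal_lie_ideal_def)
  note c = lie_ideal_carrier[OF A] lie_ideal_carrier[OF B] lie_ideal_carrier[OF M']
  have "bracket L x y \<in> M" if x: "x \<in> carrier L" and y: "y \<in> carrier L" for x y
  proof -
    have "x \<in> A <+>\<^bsub>L\<^esub> M" "y \<in> B <+>\<^bsub>L\<^esub> M" using sum x y by simp_all
    then obtain a m b m' where *: "a \<in> A" "m \<in> M" "b \<in> B" "m' \<in> M" "x = a \<oplus>\<^bsub>L\<^esub> m" "y = b \<oplus>\<^bsub>L\<^esub> m'"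
      by (auto simp: set_add_def')
    then have "bracket L x y = (bracket L a b \<oplus>\<^bsub>L\<^esub> bracket L a m') \<oplus>\<^bsub>L\<^esub> bracket L m y"
      using c by (simp add: bracket_add_left bracket_add_right bracket_closed M.a_ac)
    then show ?thesis
      using * c y AB by (simp add: lie_ideal_add[OF M'] lie_ideal_bracket[OF M'] lie_ideal_bracket'[OF M'])
  qed
  then show False
    using perfect M by (auto simp: perfect_lie_algebra_def maximal_lie_ideal_def)
qed

text \<open>Since \<open>[A, B] \<subseteq> A \<inter> B\<close>, primeness passes from brackets to finite intersections.\<close>
lemma maximal_lie_ideal_contains_factor:
  assumes "perfect_lie_algebra K L" and M: "maximal_lie_ideal M K L"
    and "finite F" "\<And>i. i \<in> F \<Longrightarrow> lie_ideal (A i) K L"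
    and "{x \<in> carrier L. \<forall>i \<in> F. x \<in> A i} \<subseteq> M"
  shows "\<exists>i \<in> F. A i \<subseteq> M"
  using assms(3,4,5)
proof (induction F)
  case empty
  then show ?case using M lie_ideal_carrier[of M] by (auto simp: maximal_lie_ideal_def)
next
  case (insert i F)
  let ?B = "{x \<in> carrier L. \<forall>i \<in> F. x \<in> A i}"
  have i: "lie_ideal (A i) K L" and B: "lie_ideal ?B K L"
    using insert.prems by (auto intro: lie_ideal_Inter)
  have "bracket L a b \<in> M" if a: "a \<in> A i" and b: "b \<in> ?B" for a b
    using lie_ideal_bracket[OF B lie_ideal_carrier[OF i a] b]
      lie_ideal_bracket'[OF i a lie_ideal_carrier[OF B b]] insert.prems(2) by blast
  then have "A i \<subseteq> M \<or> ?B \<subseteq> M"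
    by (rule maximal_lie_ideal_prime[OF assms(1,2) i B])
  then show ?case using insert by auto
qed

text \<open>The congruences are solved one at a time. A maximal ideal that has not occurred before cannot
  contain the intersection of the earlier ones, hence together with it spans \<open>L\<close>; so a solution can be
  corrected by an element of this intersection. Repeated ideals are admitted, with equal right-hand
  sides, because different characters may give the same translate of an ideal.\<close>
lemma chinese_remainder_maximal_lie_ideals:
  assumes perfect: "perfect_lie_algebra K L" and "finite F"
    and "\<And>i. i \<in> F \<Longrightarrow> maximal_lie_ideal (M i) K L"
    and "\<And>i. i \<in> F \<Longrightarrow> t i \<in> carrier L"
    and "\<And>i j. i \<in> F \<Longrightarrow> j \<in> F \<Longrightarrow> M i = M j \<Longrightarrow> t i = t j"
  shows "\<exists>y \<in> carrier L. \<forall>i \<in> F. y \<ominus>\<^bsub>L\<^esub> t i \<in> M i"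
  using assms(2-)
proof (induction F)
  case empty
  then show ?case using M.zero_closed by blast
next
  case (insert i F)
  have "\<exists>y \<in> carrier L. \<forall>j \<in> F. y \<ominus>\<^bsub>L\<^esub> t j \<in> M j"
    by (rule insert.IH) (blast intro: insert.prems)+
  then obtain y where y: "y \<in> carrier L" "\<And>j. j \<in> F \<Longrightarrow> y \<ominus>\<^bsub>L\<^esub> t j \<in> M j" by blast
  have ideal: "lie_ideal (M j) K L" if "j \<in> insert i F" for j
    using insert.prems(1)[OF that] by (simp add: maximal_lie_ideal_def)
  show ?case
  proof (cases "\<exists>j \<in> F. M j = M i")
    case True
    then obtain j where "j \<in> F" "M j = M i" "t j = t i" using insert.prems(3) by (meson insertI1 insertI2)
    then have "y \<ominus>\<^bsub>L\<^esub> t i \<in> M i" using y(2)[of j] by simp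
    then show ?thesis using y by auto
  next
    case False
    let ?B = "{x \<in> carrier L. \<forall>j \<in> F. x \<in> M j}"
    have B: "lie_ideal ?B K L" using ideal by (intro lie_ideal_Inter) simp
    have M: "maximal_lie_ideal (M i) K L" and t: "t i \<in> carrier L" using insert.prems(1,2)[of i] by simp_all
    have "\<not> ?B \<subseteq> M i"
    proof
      assume "?B \<subseteq> M i"
      then obtain j where j: "j \<in> F" "M j \<subseteq> M i"
        using maximal_lie_ideal_contains_factor[OF perfect M insert.hyps(1), of M] ideal by auto
      then have "M i = M j \<or> M i = carrier L"
        using insert.prems(1)[of j] ideal[of i] by (auto simp: maximal_lie_ideal_def)
      then show False using False j M by (auto simp: maximal_lie_ideal_def)
    qed
    then have "t i \<ominus>\<^bsub>L\<^esub> y \<in> ?B <+>\<^bsub>L\<^esub> M i"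
      using maximal_lie_ideal_sum_eq_carrier[OF M B] t y by simp
    then obtain u v where uv: "u \<in> ?B" "v \<in> M i" "t i \<ominus>\<^bsub>L\<^esub> y = u \<oplus>\<^bsub>L\<^esub> v"
      unfolding set_add_def' by blast
    have v: "v \<in> carrier L" and u: "u \<in> carrier L"
      using uv lie_ideal_carrier[OF ideal[of i]] by auto
    have "t i = (t i \<ominus>\<^bsub>L\<^esub> y) \<oplus>\<^bsub>L\<^esub> y" using t y by (simp add: a_minus_def M.a_assoc M.l_neg)
    then have "(y \<oplus>\<^bsub>L\<^esub> u) \<ominus>\<^bsub>L\<^esub> t i = \<ominus>\<^bsub>L\<^esub> v"
      using u v y uv(3) by (simp add: a_minus_def M.minus_add M.a_ac M.r_neg1 M.r_neg2)
    moreover have "(y \<oplus>\<^bsub>L\<^esub> u) \<ominus>\<^bsub>L\<^esub> t j = (y \<ominus>\<^bsub>L\<^esub> t j) \<oplus>\<^bsub>L\<^esub> u" if "j \<in> F" for j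
      using that insert.prems(2)[of j] y u by (simp add: a_minus_def M.a_ac)
    moreover have "\<ominus>\<^bsub>L\<^esub> v \<in> M i" using uv(2) ideal[of i] lie_ideal_uminus by simp
    moreover have "(y \<ominus>\<^bsub>L\<^esub> t j) \<oplus>\<^bsub>L\<^esub> u \<in> M j" if "j \<in> F" for j
      using that y(2) uv(1) ideal[of j] by (simp add: lie_ideal_add)
    ultimately show ?thesis using y u by (intro bexI[of _ "y \<oplus>\<^bsub>L\<^esub> u"]) auto
  qed
qed

end

section \<open>Quotient Lie algebras\<close>

locale lie_epimorphism = lie_algebra K L + A: lie_algebra K A
  for K :: "('k, 'n) ring_scheme" (structure) and L :: "('k, 'a, 'm) lie_algebra_scheme" (structure)
    and A :: "('k, 'b, 'l) lie_algebra_scheme" +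
  fixes \<pi> :: "'a \<Rightarrow> 'b"
  assumes surj: "\<pi> ` carrier L = carrier A"
    and \<pi>_add: "\<lbrakk>x \<in> carrier L; y \<in> carrier L\<rbrakk> \<Longrightarrow> \<pi> (x \<oplus>\<^bsub>L\<^esub> y) = \<pi> x \<oplus>\<^bsub>A\<^esub> \<pi> y"
    and \<pi>_smult: "\<lbrakk>c \<in> carrier K; x \<in> carrier L\<rbrakk> \<Longrightarrow> \<pi> (c \<odot>\<^bsub>L\<^esub> x) = c \<odot>\<^bsub>A\<^esub> \<pi> x"
    and \<pi>_bracket: "\<lbrakk>x \<in> carrier L; y \<in> carrier L\<rbrakk> \<Longrightarrow> \<pi> (bracket L x y) = bracket A (\<pi> x) (\<pi> y)"
begin

lemma \<pi>_closed [simp]: "x \<in> carrier L \<Longrightarrow> \<pi> x \<in> carrier A"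
  using surj by blast

lemma \<pi>_zero [simp]: "\<pi> \<zero>\<^bsub>L\<^esub> = \<zero>\<^bsub>A\<^esub>"
  using \<pi>_smult[of \<zero> "\<zero>\<^bsub>L\<^esub>"] by simp

lemma \<pi>_minus:
  assumes "x \<in> carrier L" "y \<in> carrier L"
  shows "\<pi> (x \<ominus>\<^bsub>L\<^esub> y) = \<pi> x \<ominus>\<^bsub>A\<^esub> \<pi> y"
  using assms \<pi>_add[of x "\<ominus>\<^bsub>L\<^esub> y"] \<pi>_smult[of "\<ominus> \<one>" y]
  by (simp add: a_minus_def minus_smult A.minus_smult)

lemma simple_lie_algebra_quotient:
  assumes perfect: "perfect_lie_algebra K L"
    and maximal: "maximal_lie_ideal {x \<in> carrier L. \<pi> x = \<zero>\<^bsub>A\<^esub>} K L"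
  shows "simple_lie_algebra K A"
proof -
  let ?I = "{x \<in> carrier L. \<pi> x = \<zero>\<^bsub>A\<^esub>}"
  have "\<not> lie_commutative A"
  proof
    assume "lie_commutative A"
    then have "bracket L x y \<in> ?I" if "x \<in> carrier L" "y \<in> carrier L" for x y
      using that by (simp add: lie_commutative_def \<pi>_bracket bracket_closed)
    then show False using perfect maximal by (auto simp: perfect_lie_algebra_def maximal_lie_ideal_def)
  qed
  moreover have "J = {\<zero>\<^bsub>A\<^esub>} \<or> J = carrier A" if J: "lie_ideal J K A" for J
  proof -
    define J' where "J' = {x \<in> carrier L. \<pi> x \<in> J}"
    have "lie_ideal J' K L" unfolding J'_def
      by (rule lie_idealI) (auto simp: \<pi>_add \<pi>_smult \<pi>_bracket bracket_closed A.lie_ideal_zero[OF J]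
          A.lie_ideal_add[OF J] A.lie_ideal_smult[OF J] A.lie_ideal_bracket[OF J])
    moreover have "?I \<subseteq> J'" using A.lie_ideal_zero[OF J] by (auto simp: J'_def)
    ultimately have "J' = ?I \<or> J' = carrier L"
      using maximal unfolding maximal_lie_ideal_def by blast
    moreover have "\<pi> ` ?I = {\<zero>\<^bsub>A\<^esub>}" using \<pi>_zero by force
    moreover have "J = \<pi> ` J'" using A.lie_ideal_carrier[OF J] surj by (auto simp: J'_def)
    ultimately show ?thesis using surj by auto
  qed
  ultimately show ?thesis by (simp add: simple_lie_algebra_def A.lie_algebra_axioms)
qed

end

text \<open>All axioms are equations or closure conditions and transfer along a surjection; this provides the
  structure on the quotient.\<close>
lemma (in lie_algebra) lie_epimorphism_image:
  fixes A :: "('k, 'b, 'l) lie_algebra_scheme" and \<pi> :: "'a \<Rightarrow> 'b"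
  assumes carrier: "carrier A = \<pi> ` carrier L" and zero: "\<pi> \<zero>\<^bsub>L\<^esub> = \<zero>\<^bsub>A\<^esub>"
    and add: "\<And>x y. \<lbrakk>x \<in> carrier L; y \<in> carrier L\<rbrakk> \<Longrightarrow> \<pi> x \<oplus>\<^bsub>A\<^esub> \<pi> y = \<pi> (x \<oplus>\<^bsub>L\<^esub> y)"
    and smult: "\<And>c x. \<lbrakk>c \<in> carrier K; x \<in> carrier L\<rbrakk> \<Longrightarrow> c \<odot>\<^bsub>A\<^esub> \<pi> x = \<pi> (c \<odot>\<^bsub>L\<^esub> x)"
    and bracket: "\<And>x y. \<lbrakk>x \<in> carrier L; y \<in> carrier L\<rbrakk> \<Longrightarrow> bracket A (\<pi> x) (\<pi> y) = \<pi> (bracket L x y)"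
  shows "lie_epimorphism K L A \<pi>"
proof -
  have "abelian_group A"
  proof (rule abelian_groupI)
    show "\<exists>y \<in> carrier A. y \<oplus>\<^bsub>A\<^esub> x = \<zero>\<^bsub>A\<^esub>" if x: "x \<in> carrier A" for x
    proof -
      obtain a where "a \<in> carrier L" "x = \<pi> a" using x by (auto simp: carrier)
      then show ?thesis
        using add[of "\<ominus>\<^bsub>L\<^esub> a" a] by (auto simp: carrier zero M.l_neg)
    qed
  qed (auto simp: carrier zero[symmetric] add M.a_ac)
  then have "module K A"
    by (intro moduleI is_cring) (auto simp: carrier add smult smult_l_distr smult_r_distr smult_assoc1)
  moreover have "lie_algebra_axioms K A"
    by unfold_locales
      (auto simp: carrier zero[symmetric] add smult bracket bracket_closed bracket_add_left
        bracket_add_right bracket_smult_left bracket_smult_right bracket_self jacobi)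
  ultimately have A: "lie_algebra K A"
    by (intro lie_algebra.intro field_axioms)
  then show ?thesis
    by (intro lie_epimorphism.intro lie_epimorphism_axioms.intro A lie_algebra_axioms)
      (auto simp: carrier add smult bracket)
qed

text \<open>The quotient is realised on a set of representatives of the cosets of \<open>I\<close>, selected by \<open>\<pi>\<close>, and
  not on the cosets themselves. So its elements have the same type as those of \<open>L\<close>.\<close>
lemma (in lie_algebra) exists_quotient_lie_algebra:
  assumes I: "lie_ideal I K L"
  shows "\<exists>(A :: ('k, 'a) lie_algebra) \<pi>. lie_epimorphism K L A \<pi> \<and> {x \<in> carrier L. \<pi> x = \<zero>\<^bsub>A\<^esub>} = I"
proof -
  define \<pi> where "\<pi> x = (SOME y. y \<in> carrier L \<and> y \<ominus>\<^bsub>L\<^esub> x \<in> I)" for x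
  have \<pi>: "\<pi> x \<in> carrier L" "\<pi> x \<ominus>\<^bsub>L\<^esub> x \<in> I" if "x \<in> carrier L" for x
  proof -
    have "x \<in> carrier L \<and> x \<ominus>\<^bsub>L\<^esub> x \<in> I" using that lie_ideal_zero[OF I] by (simp add: a_minus_def M.r_neg)
    then have "\<pi> x \<in> carrier L \<and> \<pi> x \<ominus>\<^bsub>L\<^esub> x \<in> I" unfolding \<pi>_def by (rule someI)
    then show "\<pi> x \<in> carrier L" "\<pi> x \<ominus>\<^bsub>L\<^esub> x \<in> I" by simp_all
  qed
  have diff_trans: "x \<ominus>\<^bsub>L\<^esub> z = (x \<ominus>\<^bsub>L\<^esub> y) \<oplus>\<^bsub>L\<^esub> (y \<ominus>\<^bsub>L\<^esub> z)"
    if "x \<in> carrier L" "y \<in> carrier L" "z \<in> carrier L" for x y z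
    using that by (simp add: a_minus_def M.a_ac M.r_neg1 M.r_neg2)
  have diff_sym: "y \<ominus>\<^bsub>L\<^esub> x = \<ominus>\<^bsub>L\<^esub> (x \<ominus>\<^bsub>L\<^esub> y)" if "x \<in> carrier L" "y \<in> carrier L" for x y
    using that by (simp add: a_minus_def M.minus_add M.a_ac)
  have \<pi>_eq_iff: "\<pi> x = \<pi> y \<longleftrightarrow> x \<ominus>\<^bsub>L\<^esub> y \<in> I" if x: "x \<in> carrier L" and y: "y \<in> carrier L" for x y
  proof
    assume "\<pi> x = \<pi> y"
    then have "x \<ominus>\<^bsub>L\<^esub> y = \<ominus>\<^bsub>L\<^esub> (\<pi> x \<ominus>\<^bsub>L\<^esub> x) \<oplus>\<^bsub>L\<^esub> (\<pi> y \<ominus>\<^bsub>L\<^esub> y)"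
      using diff_trans[of x "\<pi> x" y] diff_sym[of "\<pi> x" x] x y \<pi>(1) by simp
    then show "x \<ominus>\<^bsub>L\<^esub> y \<in> I" using \<pi>(2) x y I by (simp add: lie_ideal_add lie_ideal_uminus)
  next
    assume xy: "x \<ominus>\<^bsub>L\<^esub> y \<in> I"
    then have yx: "y \<ominus>\<^bsub>L\<^esub> x \<in> I" using diff_sym[OF x y] lie_ideal_uminus[OF I xy] by simp
    have "z \<ominus>\<^bsub>L\<^esub> x \<in> I \<longleftrightarrow> z \<ominus>\<^bsub>L\<^esub> y \<in> I" if "z \<in> carrier L" for z
      using diff_trans[of z x y] diff_trans[of z y x] that x y xy yx lie_ideal_add[OF I] by metis
    then show "\<pi> x = \<pi> y" unfolding \<pi>_def by (metis (no_types, lifting))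
  qed
  define A :: "('k, 'a) lie_algebra" where
    "A = \<lparr>carrier = \<pi> ` carrier L, monoid.mult = undefined, one = undefined, ring.zero = \<pi> \<zero>\<^bsub>L\<^esub>,
      ring.add = (\<lambda>x y. \<pi> (x \<oplus>\<^bsub>L\<^esub> y)), module.smult = (\<lambda>c x. \<pi> (c \<odot>\<^bsub>L\<^esub> x)),
      bracket = (\<lambda>x y. \<pi> (bracket L x y))\<rparr>"
  have epi: "lie_epimorphism K L A \<pi>"
  proof (rule lie_epimorphism_image)
    show "\<pi> x \<oplus>\<^bsub>A\<^esub> \<pi> y = \<pi> (x \<oplus>\<^bsub>L\<^esub> y)" if x: "x \<in> carrier L" and y: "y \<in> carrier L" for x y
    proof -
      have "(\<pi> x \<oplus>\<^bsub>L\<^esub> \<pi> y) \<ominus>\<^bsub>L\<^esub> (x \<oplus>\<^bsub>L\<^esub> y) = (\<pi> x \<ominus>\<^bsub>L\<^esub> x) \<oplus>\<^bsub>L\<^esub> (\<pi> y \<ominus>\<^bsub>L\<^esub> y)"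
        using x y \<pi>(1) by (simp add: a_minus_def M.minus_add M.a_ac)
      then show ?thesis using x y \<pi> \<pi>_eq_iff lie_ideal_add[OF I] by (simp add: A_def)
    qed
    show "c \<odot>\<^bsub>A\<^esub> \<pi> x = \<pi> (c \<odot>\<^bsub>L\<^esub> x)" if c: "c \<in> carrier K" and x: "x \<in> carrier L" for c x
    proof -
      have "c \<odot>\<^bsub>L\<^esub> \<pi> x \<ominus>\<^bsub>L\<^esub> c \<odot>\<^bsub>L\<^esub> x = c \<odot>\<^bsub>L\<^esub> (\<pi> x \<ominus>\<^bsub>L\<^esub> x)"
        using c x \<pi>(1) by (simp add: a_minus_def smult_r_distr smult_r_minus)
      then show ?thesis using c x \<pi> \<pi>_eq_iff lie_ideal_smult[OF I] by (simp add: A_def)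
    qed
    show "bracket A (\<pi> x) (\<pi> y) = \<pi> (bracket L x y)" if x: "x \<in> carrier L" and y: "y \<in> carrier L" for x y
    proof -
      define u v where "u = \<pi> x \<ominus>\<^bsub>L\<^esub> x" and "v = \<pi> y \<ominus>\<^bsub>L\<^esub> y"
      have uv: "u \<in> I" "v \<in> I" and uv': "u \<in> carrier L" "v \<in> carrier L"
        using x y \<pi> by (simp_all add: u_def v_def)
      have "\<pi> x = x \<oplus>\<^bsub>L\<^esub> u" "\<pi> y = y \<oplus>\<^bsub>L\<^esub> v"
        using x y \<pi>(1) by (simp_all add: u_def v_def add_diff_cancel)
      then have "bracket L (\<pi> x) (\<pi> y) = (bracket L x v \<oplus>\<^bsub>L\<^esub> bracket L u (\<pi> y)) \<oplus>\<^bsub>L\<^esub> bracket L x y"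
        using x y uv' by (simp add: bracket_add_left bracket_add_right bracket_closed M.a_ac)
      then have "bracket L (\<pi> x) (\<pi> y) \<ominus>\<^bsub>L\<^esub> bracket L x y = bracket L x v \<oplus>\<^bsub>L\<^esub> bracket L u (\<pi> y)"
        using x y \<pi>(1) uv' bracket_closed by (simp add: a_minus_def M.a_assoc M.r_neg)
      also have "\<dots> \<in> I"
        using x y \<pi>(1) uv lie_ideal_add[OF I] lie_ideal_bracket[OF I] lie_ideal_bracket'[OF I] by simp
      finally show ?thesis using x y \<pi>(1) \<pi>_eq_iff bracket_closed by (simp add: A_def)
    qed
  qed (simp_all add: A_def)
  have "\<pi> x = \<zero>\<^bsub>A\<^esub> \<longleftrightarrow> x \<in> I" if "x \<in> carrier L" for x
    using that \<pi>_eq_iff[of x "\<zero>\<^bsub>L\<^esub>"] add_diff_cancel[of x "\<zero>\<^bsub>L\<^esub>"] by (simp add: A_def)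
  then have "{x \<in> carrier L. \<pi> x = \<zero>\<^bsub>A\<^esub>} = I" using lie_ideal_carrier[OF I] by blast
  with epi show ?thesis by blast
qed

section \<open>Homogeneous components\<close>

locale finite_graded_lie_algebra = lie_algebra K L + Q: comm_group Q
  for K :: "('k, 'n) ring_scheme" (structure) and L :: "('k, 'a, 'm) lie_algebra_scheme" (structure)
    and Q :: "('q, 'p) monoid_scheme" +
  fixes D :: "'q \<Rightarrow> 'a set"
  assumes finite_Q: "finite (carrier Q)" and graded: "graded_lie_algebra K Q L D"
begin

text \<open>Meaningful for \<open>\<alpha>\<close> in \<open>carrier Q\<close> only, since the decompositions are extensional functions.\<close>
definition component :: "'q \<Rightarrow> 'a \<Rightarrow> 'a" where
  "component \<alpha> x = (THE f. f \<in> (\<Pi>\<^sub>E \<beta> \<in> carrier Q. D \<beta>) \<and> x = finsum L f (carrier Q)) \<alpha>"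

lemma D_submodule: "\<alpha> \<in> carrier Q \<Longrightarrow> submodule (D \<alpha>) K L"
  using graded by (simp add: graded_lie_algebra_def internal_direct_sum_finite[OF finite_Q])

lemma D_closed: "\<alpha> \<in> carrier Q \<Longrightarrow> x \<in> D \<alpha> \<Longrightarrow> x \<in> carrier L"
  using D_submodule submoduleE(1) by blast

lemma D_zero: "\<alpha> \<in> carrier Q \<Longrightarrow> \<zero>\<^bsub>L\<^esub> \<in> D \<alpha>"
  using D_submodule submodule_zero_closed by blast

lemma D_add: "\<alpha> \<in> carrier Q \<Longrightarrow> x \<in> D \<alpha> \<Longrightarrow> y \<in> D \<alpha> \<Longrightarrow> x \<oplus>\<^bsub>L\<^esub> y \<in> D \<alpha>"
  using D_submodule submoduleE(5) by blast

lemma D_smult: "\<alpha> \<in> carrier Q \<Longrightarrow> c \<in> carrier K \<Longrightarrow> x \<in> D \<alpha> \<Longrightarrow> c \<odot>\<^bsub>L\<^esub> x \<in> D \<alpha>"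
  using D_submodule submoduleE(4) by blast

lemma D_bracket:
  "\<alpha> \<in> carrier Q \<Longrightarrow> \<beta> \<in> carrier Q \<Longrightarrow> x \<in> D \<alpha> \<Longrightarrow> y \<in> D \<beta> \<Longrightarrow> bracket L x y \<in> D (\<alpha> \<otimes>\<^bsub>Q\<^esub> \<beta>)"
  using graded by (simp add: graded_lie_algebra_def)

lemma unique_decomposition:
  "x \<in> carrier L \<Longrightarrow> \<exists>!f. f \<in> (\<Pi>\<^sub>E \<beta> \<in> carrier Q. D \<beta>) \<and> x = finsum L f (carrier Q)"
  using graded by (simp add: graded_lie_algebra_def internal_direct_sum_finite[OF finite_Q])

lemma component_in_D: "x \<in> carrier L \<Longrightarrow> \<alpha> \<in> carrier Q \<Longrightarrow> component \<alpha> x \<in> D \<alpha>"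
  using theI'[OF unique_decomposition[of x]] unfolding component_def by blast

lemma component_closed [simp]: "x \<in> carrier L \<Longrightarrow> \<alpha> \<in> carrier Q \<Longrightarrow> component \<alpha> x \<in> carrier L"
  using component_in_D D_closed by blast

lemma finsum_components: "x \<in> carrier L \<Longrightarrow> finsum L (\<lambda>\<alpha>. component \<alpha> x) (carrier Q) = x"
  using theI'[OF unique_decomposition[of x]] unfolding component_def by simp

lemma component_unique:
  assumes f: "\<And>\<alpha>. \<alpha> \<in> carrier Q \<Longrightarrow> f \<alpha> \<in> D \<alpha>" and x: "x = finsum L f (carrier Q)"
    and \<alpha>: "\<alpha> \<in> carrier Q"
  shows "component \<alpha> x = f \<alpha>"
proof -
  have fL: "f \<in> carrier Q \<rightarrow> carrier L" using f D_closed by auto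
  then have xL: "x \<in> carrier L" using x by simp
  have "restrict f (carrier Q) \<in> (\<Pi>\<^sub>E \<beta> \<in> carrier Q. D \<beta>)" using f by simp
  moreover have "x = finsum L (restrict f (carrier Q)) (carrier Q)"
    using x fL by (auto intro!: M.finsum_cong')
  ultimately have "(THE f. f \<in> (\<Pi>\<^sub>E \<beta> \<in> carrier Q. D \<beta>) \<and> x = finsum L f (carrier Q)) = restrict f (carrier Q)"
    using unique_decomposition[OF xL] by (intro the1_equality) auto
  then show ?thesis using \<alpha> by (simp add: component_def)
qed

lemma component_eqI:
  assumes "x \<in> carrier L" "y \<in> carrier L" "\<And>\<alpha>. \<alpha> \<in> carrier Q \<Longrightarrow> component \<alpha> x = component \<alpha> y"
  shows "x = y"
proof -
  have "finsum L (\<lambda>\<alpha>. component \<alpha> x) (carrier Q) = finsum L (\<lambda>\<alpha>. component \<alpha> y) (carrier Q)"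
    using assms by (intro M.finsum_cong') auto
  then show ?thesis using assms finsum_components by simp
qed

lemma component_add:
  assumes "x \<in> carrier L" "y \<in> carrier L" "\<alpha> \<in> carrier Q"
  shows "component \<alpha> (x \<oplus>\<^bsub>L\<^esub> y) = component \<alpha> x \<oplus>\<^bsub>L\<^esub> component \<alpha> y"
proof (rule component_unique)
  show "x \<oplus>\<^bsub>L\<^esub> y = finsum L (\<lambda>\<alpha>. component \<alpha> x \<oplus>\<^bsub>L\<^esub> component \<alpha> y) (carrier Q)"
    using assms by (subst M.finsum_addf) (auto simp: finsum_components)
qed (use assms in \<open>simp_all add: D_add component_in_D\<close>)

lemma component_smult:
  assumes "c \<in> carrier K" "x \<in> carrier L" "\<alpha> \<in> carrier Q"
  shows "component \<alpha> (c \<odot>\<^bsub>L\<^esub> x) = c \<odot>\<^bsub>L\<^esub> component \<alpha> x"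
proof (rule component_unique)
  show "c \<odot>\<^bsub>L\<^esub> x = finsum L (\<lambda>\<alpha>. c \<odot>\<^bsub>L\<^esub> component \<alpha> x) (carrier Q)"
    using assms finsum_additive[OF M.abelian_group_axioms M.abelian_group_axioms, of "\<lambda>x. c \<odot>\<^bsub>L\<^esub> x"
      "carrier Q" "\<lambda>\<alpha>. component \<alpha> x"]
    by (simp add: smult_r_distr finsum_components)
qed (use assms in \<open>simp_all add: D_smult component_in_D\<close>)

lemma component_minus:
  assumes "x \<in> carrier L" "y \<in> carrier L" "\<alpha> \<in> carrier Q"
  shows "component \<alpha> (x \<ominus>\<^bsub>L\<^esub> y) = component \<alpha> x \<ominus>\<^bsub>L\<^esub> component \<alpha> y"
  using assms by (simp add: a_minus_def minus_smult component_add component_smult)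

lemma component_homogeneous:
  assumes x: "x \<in> D \<alpha>" and \<alpha>: "\<alpha> \<in> carrier Q" "\<beta> \<in> carrier Q"
  shows "component \<beta> x = (if \<beta> = \<alpha> then x else \<zero>\<^bsub>L\<^esub>)"
proof (rule component_unique)
  have "finsum L (\<lambda>\<beta>. if \<beta> = \<alpha> then x else \<zero>\<^bsub>L\<^esub>) (carrier Q) = x"
    using M.add.finprod_singleton_swap[OF \<alpha>(1) finite_Q, of "\<lambda>_. x"] D_closed[OF \<alpha>(1) x] by simp
  then show "x = finsum L (\<lambda>\<beta>. if \<beta> = \<alpha> then x else \<zero>\<^bsub>L\<^esub>) (carrier Q)" by simp
qed (use x \<alpha> D_zero in auto)

lemma component_zero: "\<alpha> \<in> carrier Q \<Longrightarrow> component \<alpha> \<zero>\<^bsub>L\<^esub> = \<zero>\<^bsub>L\<^esub>"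
  using component_homogeneous[of "\<zero>\<^bsub>L\<^esub>" \<alpha> \<alpha>] D_zero by simp

lemma component_bracket_homogeneous:
  assumes x: "x \<in> D \<alpha>" "\<alpha> \<in> carrier Q" and y: "y \<in> carrier L" and \<gamma>: "\<gamma> \<in> carrier Q"
  shows "component \<gamma> (bracket L x y) = bracket L x (component (inv\<^bsub>Q\<^esub> \<alpha> \<otimes>\<^bsub>Q\<^esub> \<gamma>) y)"
proof (rule component_unique)
  have xL: "x \<in> carrier L" using x D_closed by blast
  show "bracket L x (component (inv\<^bsub>Q\<^esub> \<alpha> \<otimes>\<^bsub>Q\<^esub> \<beta>) y) \<in> D \<beta>" if "\<beta> \<in> carrier Q" for \<beta>
    using D_bracket[OF x(2) _ x(1) component_in_D[OF y], of "inv\<^bsub>Q\<^esub> \<alpha> \<otimes>\<^bsub>Q\<^esub> \<beta>"] x(2) that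
    by (simp flip: Q.m_assoc)
  let ?t = "\<lambda>\<beta>. inv\<^bsub>Q\<^esub> \<alpha> \<otimes>\<^bsub>Q\<^esub> \<beta>"
  have "\<beta> \<in> ?t ` carrier Q" if "\<beta> \<in> carrier Q" for \<beta>
    using that x(2) by (intro image_eqI[of _ _ "\<alpha> \<otimes>\<^bsub>Q\<^esub> \<beta>"]) (simp_all flip: Q.m_assoc)
  then have t: "?t ` carrier Q = carrier Q" using x(2) by auto
  have inj: "inj_on ?t (carrier Q)" using x(2) by (simp add: inj_on_def)
  have "bracket L x y = bracket L x (finsum L (\<lambda>\<beta>. component \<beta> y) (carrier Q))"
    using y finsum_components by simp
  also have "\<dots> = finsum L (\<lambda>\<beta>. bracket L x (component \<beta> y)) (carrier Q)"
    using xL y by (intro finsum_additive[of L L] M.abelian_group_axioms)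
      (simp_all add: bracket_closed bracket_add_right)
  also have "\<dots> = finsum L (\<lambda>\<beta>. bracket L x (component (?t \<beta>) y)) (carrier Q)"
    using M.finsum_reindex[of "\<lambda>\<beta>. bracket L x (component \<beta> y)" ?t "carrier Q"] t inj xL y x(2)
    by (auto simp: bracket_closed)
  finally show "bracket L x y = finsum L (\<lambda>\<beta>. bracket L x (component (?t \<beta>) y)) (carrier Q)" .
qed (use \<gamma> in simp)

text \<open>A convolution formula, with the second degree expressed through the first one so that the sum runs
  over \<open>carrier Q\<close>.\<close>
lemma component_bracket:
  assumes x: "x \<in> carrier L" and y: "y \<in> carrier L" and \<gamma>: "\<gamma> \<in> carrier Q"
  shows "component \<gamma> (bracket L x y) =
    finsum L (\<lambda>\<alpha>. bracket L (component \<alpha> x) (component (inv\<^bsub>Q\<^esub> \<alpha> \<otimes>\<^bsub>Q\<^esub> \<gamma>) y)) (carrier Q)"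
proof -
  have "component \<gamma> (bracket L x y) = component \<gamma> (bracket L (finsum L (\<lambda>\<alpha>. component \<alpha> x) (carrier Q)) y)"
    using x finsum_components by simp
  also have "\<dots> = finsum L (\<lambda>\<alpha>. component \<gamma> (bracket L (component \<alpha> x) y)) (carrier Q)"
    using x y \<gamma> by (intro finsum_additive[of L L] M.abelian_group_axioms)
      (simp_all add: bracket_closed bracket_add_left component_add)
  also have "\<dots> = finsum L (\<lambda>\<alpha>. bracket L (component \<alpha> x) (component (inv\<^bsub>Q\<^esub> \<alpha> \<otimes>\<^bsub>Q\<^esub> \<gamma>) y)) (carrier Q)"
    using x y \<gamma> by (intro M.finsum_cong')
      (auto simp: component_bracket_homogeneous[OF component_in_D] bracket_closed)
  finally show ?thesis .
qed

section \<open>The action of characters on a graded Lie algebra\<close>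

definition act :: "('q \<Rightarrow> 'k) \<Rightarrow> 'a \<Rightarrow> 'a" where
  "act \<chi> x = finsum L (\<lambda>\<alpha>. \<chi> \<alpha> \<odot>\<^bsub>L\<^esub> component \<alpha> x) (carrier Q)"

lemma act_closed [simp]: "\<chi> \<in> carrier Q \<rightarrow> carrier K \<Longrightarrow> x \<in> carrier L \<Longrightarrow> act \<chi> x \<in> carrier L"
  unfolding act_def by (auto intro!: M.finsum_closed simp: Pi_def)

text \<open>Together with \<open>component_eqI\<close> this reduces identities about the action to identities in \<open>K\<close>.\<close>
lemma component_act:
  assumes "\<chi> \<in> carrier Q \<rightarrow> carrier K" "x \<in> carrier L" "\<alpha> \<in> carrier Q"
  shows "component \<alpha> (act \<chi> x) = \<chi> \<alpha> \<odot>\<^bsub>L\<^esub> component \<alpha> x"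
  by (rule component_unique[OF _ act_def]) (use assms in \<open>auto simp: D_smult component_in_D Pi_def\<close>)

lemma act_homogeneous:
  assumes "\<chi> \<in> carrier Q \<rightarrow> carrier K" "x \<in> D \<alpha>" "\<alpha> \<in> carrier Q"
  shows "act \<chi> x = \<chi> \<alpha> \<odot>\<^bsub>L\<^esub> x"
proof (rule component_eqI)
  have x: "x \<in> carrier L" using assms D_closed by blast
  show "act \<chi> x \<in> carrier L" "\<chi> \<alpha> \<odot>\<^bsub>L\<^esub> x \<in> carrier L" using assms x by (auto simp: Pi_def)
  show "component \<beta> (act \<chi> x) = component \<beta> (\<chi> \<alpha> \<odot>\<^bsub>L\<^esub> x)" if "\<beta> \<in> carrier Q" for \<beta>
    using that assms x by (auto simp: component_act component_smult component_homogeneous[OF assms(2,3)] Pi_def)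
qed

lemma act_add:
  assumes "\<chi> \<in> carrier Q \<rightarrow> carrier K" "x \<in> carrier L" "y \<in> carrier L"
  shows "act \<chi> (x \<oplus>\<^bsub>L\<^esub> y) = act \<chi> x \<oplus>\<^bsub>L\<^esub> act \<chi> y"
  by (rule component_eqI)
    (use assms in \<open>auto simp: component_act component_add smult_r_distr Pi_def\<close>)

lemma act_smult:
  assumes "\<chi> \<in> carrier Q \<rightarrow> carrier K" "c \<in> carrier K" "x \<in> carrier L"
  shows "act \<chi> (c \<odot>\<^bsub>L\<^esub> x) = c \<odot>\<^bsub>L\<^esub> act \<chi> x"
  by (rule component_eqI)
    (use assms in \<open>auto simp: component_act component_smult Pi_def R.m_comm simp flip: smult_assoc1\<close>)

lemma act_minus:
  assumes "\<chi> \<in> carrier Q \<rightarrow> carrier K" "x \<in> carrier L" "y \<in> carrier L"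
  shows "act \<chi> (x \<ominus>\<^bsub>L\<^esub> y) = act \<chi> x \<ominus>\<^bsub>L\<^esub> act \<chi> y"
  using assms by (simp add: a_minus_def minus_smult act_add act_smult)

lemma act_zero: "\<chi> \<in> carrier Q \<rightarrow> carrier K \<Longrightarrow> act \<chi> \<zero>\<^bsub>L\<^esub> = \<zero>\<^bsub>L\<^esub>"
  by (rule component_eqI) (auto simp: component_act component_zero Pi_def)

lemma act_bracket:
  assumes \<chi>: "\<chi> \<in> carrier Q \<rightarrow> carrier K"
    and mult: "\<And>\<alpha> \<beta>. \<alpha> \<in> carrier Q \<Longrightarrow> \<beta> \<in> carrier Q \<Longrightarrow> \<chi> (\<alpha> \<otimes>\<^bsub>Q\<^esub> \<beta>) = \<chi> \<alpha> \<otimes> \<chi> \<beta>"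
    and x: "x \<in> carrier L" and y: "y \<in> carrier L"
  shows "act \<chi> (bracket L x y) = bracket L (act \<chi> x) (act \<chi> y)"
proof (rule component_eqI)
  show "act \<chi> (bracket L x y) \<in> carrier L" "bracket L (act \<chi> x) (act \<chi> y) \<in> carrier L"
    using \<chi> x y by (simp_all add: bracket_closed)
  fix \<gamma> assume \<gamma>: "\<gamma> \<in> carrier Q"
  have \<chi>c: "\<chi> \<alpha> \<in> carrier K" if "\<alpha> \<in> carrier Q" for \<alpha> using \<chi> that by auto
  let ?b = "\<lambda>\<alpha>. bracket L (component \<alpha> x) (component (inv\<^bsub>Q\<^esub> \<alpha> \<otimes>\<^bsub>Q\<^esub> \<gamma>) y)"
  have b: "?b \<alpha> \<in> carrier L" if "\<alpha> \<in> carrier Q" for \<alpha> using that x y \<gamma> by (simp add: bracket_closed)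
  have "bracket L (\<chi> \<alpha> \<odot>\<^bsub>L\<^esub> component \<alpha> x) (\<chi> (inv\<^bsub>Q\<^esub> \<alpha> \<otimes>\<^bsub>Q\<^esub> \<gamma>) \<odot>\<^bsub>L\<^esub> component (inv\<^bsub>Q\<^esub> \<alpha> \<otimes>\<^bsub>Q\<^esub> \<gamma>) y)
      = \<chi> \<gamma> \<odot>\<^bsub>L\<^esub> ?b \<alpha>" if \<alpha>: "\<alpha> \<in> carrier Q" for \<alpha>
  proof -
    have "\<chi> \<gamma> = \<chi> \<alpha> \<otimes> \<chi> (inv\<^bsub>Q\<^esub> \<alpha> \<otimes>\<^bsub>Q\<^esub> \<gamma>)"
      using mult[of \<alpha> "inv\<^bsub>Q\<^esub> \<alpha> \<otimes>\<^bsub>Q\<^esub> \<gamma>"] \<alpha> \<gamma> by (simp flip: Q.m_assoc)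
    also have "\<dots> = \<chi> (inv\<^bsub>Q\<^esub> \<alpha> \<otimes>\<^bsub>Q\<^esub> \<gamma>) \<otimes> \<chi> \<alpha>"
      using \<alpha> \<gamma> \<chi>c by (intro R.m_comm) simp_all
    finally have "\<chi> \<gamma> = \<chi> (inv\<^bsub>Q\<^esub> \<alpha> \<otimes>\<^bsub>Q\<^esub> \<gamma>) \<otimes> \<chi> \<alpha>" .
    then show ?thesis
      using \<alpha> \<gamma> x y \<chi>c by (simp add: bracket_smult_left bracket_smult_right bracket_closed smult_assoc1)
  qed
  then have "component \<gamma> (bracket L (act \<chi> x) (act \<chi> y)) = finsum L (\<lambda>\<alpha>. \<chi> \<gamma> \<odot>\<^bsub>L\<^esub> ?b \<alpha>) (carrier Q)"
    using \<chi> x y \<gamma> b \<chi>c by (auto simp: component_bracket component_act intro!: M.finsum_cong')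
  also have "\<dots> = \<chi> \<gamma> \<odot>\<^bsub>L\<^esub> finsum L ?b (carrier Q)"
    using b \<chi>c[OF \<gamma>]
    by (intro finsum_additive[symmetric, of L L] M.abelian_group_axioms) (simp_all add: smult_r_distr)
  finally show "component \<gamma> (act \<chi> (bracket L x y)) = component \<gamma> (bracket L (act \<chi> x) (act \<chi> y))"
    using \<chi> x y \<gamma> by (simp add: component_act component_bracket bracket_closed)
qed

lemma act_act:
  assumes "\<chi> \<in> carrier Q \<rightarrow> carrier K" "\<psi> \<in> carrier Q \<rightarrow> carrier K" "x \<in> carrier L"
    and "\<And>\<alpha>. \<alpha> \<in> carrier Q \<Longrightarrow> \<theta> \<alpha> = \<chi> \<alpha> \<otimes> \<psi> \<alpha>"
  shows "act \<chi> (act \<psi> x) = act \<theta> x"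
proof (rule component_eqI)
  have \<theta>: "\<theta> \<in> carrier Q \<rightarrow> carrier K" using assms by (auto simp: Pi_def)
  then show "act \<theta> x \<in> carrier L" "act \<chi> (act \<psi> x) \<in> carrier L" using assms by auto
  show "component \<alpha> (act \<chi> (act \<psi> x)) = component \<alpha> (act \<theta> x)" if "\<alpha> \<in> carrier Q" for \<alpha>
    using that assms \<theta> by (auto simp: component_act smult_assoc1 Pi_def)
qed

lemma act_one:
  assumes "x \<in> carrier L" "\<And>\<alpha>. \<alpha> \<in> carrier Q \<Longrightarrow> \<chi> \<alpha> = \<one>"
  shows "act \<chi> x = x"
proof (rule component_eqI)
  have \<chi>: "\<chi> \<in> carrier Q \<rightarrow> carrier K" using assms(2) by auto
  then show "act \<chi> x \<in> carrier L" "x \<in> carrier L" using assms by auto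
  show "component \<alpha> (act \<chi> x) = component \<alpha> x" if "\<alpha> \<in> carrier Q" for \<alpha>
    using that assms \<chi> by (simp add: component_act)
qed

text \<open>An argument of minimal support: if \<open>\<chi>\<close> separates two degrees \<open>\<alpha>\<close> and \<open>\<beta>\<close> in the support of \<open>z\<close>,
  then \<open>\<chi> z - \<chi> \<alpha> z\<close> lies in \<open>N\<close>, its support lacks \<open>\<alpha>\<close> but still contains \<open>\<beta>\<close>, and it
  contains no new degrees. With all characters it treats invariant ideals; with the stabilizer of an
  ideal it treats the elements of this ideal whose degrees lie in different cosets.\<close>
lemma separated_support_imp_zero:
  assumes N: "submodule N K L" and S: "S \<subseteq> carrier Q \<rightarrow> carrier K"
    and invariant: "\<And>\<chi> x. \<chi> \<in> S \<Longrightarrow> x \<in> N \<Longrightarrow> act \<chi> x \<in> N"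
    and homogeneous: "\<And>\<alpha> x. \<alpha> \<in> carrier Q \<Longrightarrow> x \<in> D \<alpha> \<Longrightarrow> x \<in> N \<Longrightarrow> x = \<zero>\<^bsub>L\<^esub>"
    and z: "z \<in> N"
    and separated: "\<And>\<alpha> \<beta>. \<lbrakk>\<alpha> \<in> carrier Q; \<beta> \<in> carrier Q; \<alpha> \<noteq> \<beta>; component \<alpha> z \<noteq> \<zero>\<^bsub>L\<^esub>;
      component \<beta> z \<noteq> \<zero>\<^bsub>L\<^esub>\<rbrakk> \<Longrightarrow> \<exists>\<chi> \<in> S. \<chi> \<alpha> \<noteq> \<chi> \<beta>"
  shows "z = \<zero>\<^bsub>L\<^esub>"
  using z separated
proof (induction "card {\<alpha> \<in> carrier Q. component \<alpha> z \<noteq> \<zero>\<^bsub>L\<^esub>}" arbitrary: z rule: less_induct)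
  case less
  let ?supp = "\<lambda>z. {\<alpha> \<in> carrier Q. component \<alpha> z \<noteq> \<zero>\<^bsub>L\<^esub>}"
  have zL: "z \<in> carrier L" using submoduleE(1)[OF N] less.prems(1) by blast
  show ?case
  proof (rule ccontr)
    assume "z \<noteq> \<zero>\<^bsub>L\<^esub>"
    then obtain \<alpha> where \<alpha>: "\<alpha> \<in> carrier Q" "component \<alpha> z \<noteq> \<zero>\<^bsub>L\<^esub>"
      using component_eqI[OF zL M.zero_closed] component_zero by auto
    have "\<exists>\<beta> \<in> carrier Q. \<beta> \<noteq> \<alpha> \<and> component \<beta> z \<noteq> \<zero>\<^bsub>L\<^esub>"
    proof (rule ccontr)
      assume *: "\<not> (\<exists>\<beta> \<in> carrier Q. \<beta> \<noteq> \<alpha> \<and> component \<beta> z \<noteq> \<zero>\<^bsub>L\<^esub>)"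
      have "z = component \<alpha> z"
        by (rule component_eqI)
          (use * zL \<alpha> in \<open>auto simp: component_homogeneous[OF component_in_D[OF zL \<alpha>(1)] \<alpha>(1)]\<close>)
      then show False
        using homogeneous[OF \<alpha>(1) component_in_D[OF zL \<alpha>(1)]] less.prems(1) \<alpha>(2) by simp
    qed
    then obtain \<beta> where \<beta>: "\<beta> \<in> carrier Q" "\<beta> \<noteq> \<alpha>" "component \<beta> z \<noteq> \<zero>\<^bsub>L\<^esub>" by blast
    obtain \<chi> where \<chi>: "\<chi> \<in> S" "\<chi> \<beta> \<noteq> \<chi> \<alpha>" using less.prems(2)[OF \<beta>(1) \<alpha>(1) \<beta>(2,3) \<alpha>(2)] by blast
    have \<chi>': "\<chi> \<in> carrier Q \<rightarrow> carrier K" and \<chi>c: "\<And>\<alpha>. \<alpha> \<in> carrier Q \<Longrightarrow> \<chi> \<alpha> \<in> carrier K" using \<chi> S by auto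
    define w where "w = act \<chi> z \<ominus>\<^bsub>L\<^esub> \<chi> \<alpha> \<odot>\<^bsub>L\<^esub> z"
    have w: "w \<in> N"
      unfolding w_def using less.prems(1) \<chi>(1) \<chi>c[OF \<alpha>(1)] invariant submoduleE(4)[OF N]
      by (intro submodule_minus_closed[OF N]) auto
    have comp_w: "component \<gamma> w = \<chi> \<gamma> \<odot>\<^bsub>L\<^esub> component \<gamma> z \<ominus>\<^bsub>L\<^esub> \<chi> \<alpha> \<odot>\<^bsub>L\<^esub> component \<gamma> z" if "\<gamma> \<in> carrier Q" for \<gamma>
      using that zL \<chi>' \<chi>c[OF \<alpha>(1)] by (simp add: w_def component_minus component_act component_smult)
    have "?supp w \<subseteq> ?supp z - {\<alpha>}"
      using comp_w zL \<chi>c \<alpha>(1) by (auto simp: a_minus_def M.r_neg)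
    then have sub: "?supp w \<subset> ?supp z" using \<alpha> by blast
    have "w = \<zero>\<^bsub>L\<^esub>"
    proof (rule less.hyps)
      show "card (?supp w) < card (?supp z)" using sub finite_Q by (intro psubset_card_mono) auto
      show "\<exists>\<chi> \<in> S. \<chi> \<gamma> \<noteq> \<chi> \<delta>" if "\<gamma> \<in> carrier Q" "\<delta> \<in> carrier Q" "\<gamma> \<noteq> \<delta>"
        "component \<gamma> w \<noteq> \<zero>\<^bsub>L\<^esub>" "component \<delta> w \<noteq> \<zero>\<^bsub>L\<^esub>" for \<gamma> \<delta>
        using that sub less.prems(2)[of \<gamma> \<delta>] by auto
    qed (rule w)
    then have "\<chi> \<beta> \<odot>\<^bsub>L\<^esub> component \<beta> z \<ominus>\<^bsub>L\<^esub> \<chi> \<alpha> \<odot>\<^bsub>L\<^esub> component \<beta> z = \<zero>\<^bsub>L\<^esub>"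
      using comp_w[OF \<beta>(1)] component_zero[OF \<beta>(1)] by simp
    then have "\<chi> \<beta> \<odot>\<^bsub>L\<^esub> component \<beta> z = \<chi> \<alpha> \<odot>\<^bsub>L\<^esub> component \<beta> z"
      using zL \<beta>(1) \<chi>c \<alpha>(1) by (simp add: diff_eq_zero_iff)
    then show False
      using smult_eq_imp_zero[of "\<chi> \<beta>" "\<chi> \<alpha>" "component \<beta> z"] zL \<beta> \<alpha>(1) \<chi>c \<chi>(2) by simp
  qed
qed

end

section \<open>Ideals of graded simple Lie algebras\<close>

locale finite_graded_simple_lie_algebra = finite_graded_lie_algebra +
  assumes simple: "graded_simple K Q L D"
begin

text \<open>The elements of \<open>I\<close> all of whose components lie in \<open>I\<close> form the largest graded ideal inside
  \<open>I\<close>. Graded simplicity leaves only \<open>0\<close> for it, and it contains every homogeneous element of \<open>I\<close>.\<close>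
lemma homogeneous_in_proper_ideal:
  assumes I: "lie_ideal I K L" "I \<noteq> carrier L" and x: "\<alpha> \<in> carrier Q" "x \<in> D \<alpha>" "x \<in> I"
  shows "x = \<zero>\<^bsub>L\<^esub>"
proof -
  define J where "J = {x \<in> carrier L. \<forall>\<alpha> \<in> carrier Q. component \<alpha> x \<in> I}"
  have J: "lie_ideal J K L"
  proof (rule lie_idealI)
    show "bracket L y z \<in> J" if y: "y \<in> carrier L" and z: "z \<in> J" for y z
      unfolding J_def using y z lie_ideal_bracket[OF I(1)]
      by (auto simp: J_def bracket_closed component_bracket
          intro!: submodule_finsum_closed[OF lie_ideal_submodule[OF I(1)]])
  qed (auto simp: J_def component_zero component_add component_smult
      lie_ideal_zero[OF I(1)] lie_ideal_add[OF I(1)] lie_ideal_smult[OF I(1)])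
  have homogeneous_in_J: "y \<in> J" if "\<beta> \<in> carrier Q" "y \<in> D \<beta>" "y \<in> I" for \<beta> y
    using that D_closed lie_ideal_zero[OF I(1)] by (auto simp: J_def component_homogeneous)
  have component_in_J: "component \<beta> y \<in> J \<inter> D \<beta>" if "y \<in> J" "\<beta> \<in> carrier Q" for y \<beta>
    using homogeneous_in_J[of \<beta> "component \<beta> y"] that component_in_D by (auto simp: J_def)
  have "submodule (J \<inter> D \<beta>) K L" if "\<beta> \<in> carrier Q" for \<beta>
    using lie_ideal_submodule[OF J] D_submodule[OF that]
    by (auto intro!: submoduleI dest: submoduleE submodule_zero_closed)
  moreover have "\<exists>!f. f \<in> (\<Pi>\<^sub>E \<beta> \<in> carrier Q. J \<inter> D \<beta>) \<and> y = finsum L f (carrier Q)" if y: "y \<in> J" for y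
  proof (rule ex1I[of _ "restrict (\<lambda>\<beta>. component \<beta> y) (carrier Q)"])
    have yL: "y \<in> carrier L" using y by (simp add: J_def)
    have "finsum L (restrict (\<lambda>\<beta>. component \<beta> y) (carrier Q)) (carrier Q) = y"
      using finsum_components[OF yL] yL M.finsum_cong'[of "carrier Q" "carrier Q" "\<lambda>\<beta>. component \<beta> y"
          "restrict (\<lambda>\<beta>. component \<beta> y) (carrier Q)"] by auto
    then show "restrict (\<lambda>\<beta>. component \<beta> y) (carrier Q) \<in> (\<Pi>\<^sub>E \<beta> \<in> carrier Q. J \<inter> D \<beta>) \<and>
        y = finsum L (restrict (\<lambda>\<beta>. component \<beta> y) (carrier Q)) (carrier Q)"
      using component_in_J[OF y] by auto
    show "f = restrict (\<lambda>\<beta>. component \<beta> y) (carrier Q)"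
      if f: "f \<in> (\<Pi>\<^sub>E \<beta> \<in> carrier Q. J \<inter> D \<beta>) \<and> y = finsum L f (carrier Q)" for f
    proof (rule extensionalityI[of _ "carrier Q"])
      show "f \<in> extensional (carrier Q)" using f by (auto simp: PiE_def)
      show "f \<beta> = restrict (\<lambda>\<beta>. component \<beta> y) (carrier Q) \<beta>" if "\<beta> \<in> carrier Q" for \<beta>
      proof -
        have "component \<beta> y = f \<beta>" by (rule component_unique) (use f that in auto)
        then show ?thesis using that by simp
      qed
    qed simp
  qed
  ultimately have "graded_ideal J K Q L D"
    using J lie_ideal_submodule[OF J] by (simp add: graded_ideal_def internal_direct_sum_finite[OF finite_Q])
  then have "J = {\<zero>\<^bsub>L\<^esub>} \<or> J = carrier L" using simple by (simp add: graded_simple_def)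
  then show ?thesis
  proof
    assume "J = {\<zero>\<^bsub>L\<^esub>}"
    then show ?thesis using homogeneous_in_J x by auto
  next
    assume J_all: "J = carrier L"
    have "y \<in> I" if "y \<in> carrier L" for y
      using submodule_finsum_closed[OF lie_ideal_submodule[OF I(1)], of "carrier Q" "\<lambda>\<beta>. component \<beta> y"]
        that J_all finsum_components[OF that] by (auto simp: J_def)
    then show ?thesis using I(2) lie_ideal_carrier[OF I(1)] by blast
  qed
qed

lemma ex_nonzero_homogeneous: "\<exists>\<alpha> \<in> carrier Q. \<exists>x \<in> D \<alpha>. x \<noteq> \<zero>\<^bsub>L\<^esub>"
proof (rule ccontr)
  assume "\<not> ?thesis"
  then have "x = \<zero>\<^bsub>L\<^esub>" if "x \<in> carrier L" for x
    using component_eqI[OF that M.zero_closed] component_in_D[OF that] component_zero by auto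
  then have "lie_commutative L" unfolding lie_commutative_def using bracket_closed by blast
  then show False using simple by (simp add: graded_simple_def)
qed

text \<open>A nonzero homogeneous element \<open>h\<close> lies in no proper ideal, hence not in the union of a chain of
  proper ideals. It plays the role that the unit element has for rings.\<close>
lemma exists_maximal_lie_ideal: "\<exists>I. maximal_lie_ideal I K L"
proof -
  let ?\<I> = "{J. lie_ideal J K L \<and> J \<noteq> carrier L}"
  obtain \<alpha> h where h: "\<alpha> \<in> carrier Q" "h \<in> D \<alpha>" "h \<noteq> \<zero>\<^bsub>L\<^esub>" using ex_nonzero_homogeneous by blast
  have hL: "h \<in> carrier L" using h D_closed by blast
  have "\<exists>M \<in> ?\<I>. \<forall>J \<in> ?\<I>. M \<subseteq> J \<longrightarrow> J = M"
  proof (rule subset_Zorn_nonempty)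
    have "lie_ideal {\<zero>\<^bsub>L\<^esub>} K L" by (rule lie_idealI) (auto simp: bracket_zero)
    then show "?\<I> \<noteq> {}" using h hL by blast
    show "\<Union>C \<in> ?\<I>" if "C \<noteq> {}" and C: "subset.chain ?\<I> C" for C
    proof -
      have ideal: "lie_ideal J K L" and proper: "h \<notin> J" if "J \<in> C" for J
        using C that homogeneous_in_proper_ideal[of J \<alpha> h] h by (auto simp: subset_chain_def)
      have "lie_ideal (\<Union>C) K L"
      proof (rule lie_idealI)
        show "x \<oplus>\<^bsub>L\<^esub> y \<in> \<Union>C" if xy: "x \<in> \<Union>C" "y \<in> \<Union>C" for x y
        proof -
          obtain J J' where JJ': "x \<in> J" "y \<in> J'" "J \<in> C" "J' \<in> C" using xy by blast
          then have "J \<subseteq> J' \<or> J' \<subseteq> J" using C by (auto simp: subset_chain_def)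
          then show ?thesis using JJ' ideal lie_ideal_add by blast
        qed
        show "\<zero>\<^bsub>L\<^esub> \<in> \<Union>C" using \<open>C \<noteq> {}\<close> ideal lie_ideal_zero by blast
      qed (use ideal lie_ideal_carrier lie_ideal_smult lie_ideal_bracket in blast)+
      moreover have "\<Union>C \<noteq> carrier L" using proper hL by blast
      ultimately show ?thesis by blast
    qed
  qed
  then show ?thesis by (auto simp: maximal_lie_ideal_def)
qed

text \<open>Brackets of homogeneous elements are homogeneous, so those in a proper ideal vanish. If all of
  them lie in it, \<open>L\<close> is commutative.\<close>
lemma perfect: "perfect_lie_algebra K L"
  unfolding perfect_lie_algebra_def
proof (intro allI impI, rule ccontr)
  fix J assume J: "lie_ideal J K L" "\<forall>x \<in> carrier L. \<forall>y \<in> carrier L. bracket L x y \<in> J" "J \<noteq> carrier L"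
  have homogeneous: "bracket L x y = \<zero>\<^bsub>L\<^esub>" if "\<alpha> \<in> carrier Q" "\<beta> \<in> carrier Q" "x \<in> D \<alpha>" "y \<in> D \<beta>" for \<alpha> \<beta> x y
    using homogeneous_in_proper_ideal[OF J(1,3) _ D_bracket[OF that]] that J(2) D_closed by auto
  have "bracket L x y = \<zero>\<^bsub>L\<^esub>" if x: "x \<in> carrier L" and y: "y \<in> carrier L" for x y
  proof (rule component_eqI)
    show "component \<gamma> (bracket L x y) = component \<gamma> \<zero>\<^bsub>L\<^esub>" if \<gamma>: "\<gamma> \<in> carrier Q" for \<gamma>
    proof -
      have "bracket L (component \<alpha> x) (component (inv\<^bsub>Q\<^esub> \<alpha> \<otimes>\<^bsub>Q\<^esub> \<gamma>) y) = \<zero>\<^bsub>L\<^esub>" if "\<alpha> \<in> carrier Q" for \<alpha>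
        using homogeneous[OF that _ component_in_D[OF x that] component_in_D[OF y]] that \<gamma> by simp
      then have "component \<gamma> (bracket L x y) = \<zero>\<^bsub>L\<^esub>"
        using x y \<gamma> by (simp add: component_bracket M.add.finprod_one_eqI)
      then show ?thesis using \<gamma> by (simp add: component_zero)
    qed
  qed (use x y in \<open>simp_all add: bracket_closed\<close>)
  then have "lie_commutative L" by (simp add: lie_commutative_def)
  then show False using simple by (simp add: graded_simple_def)
qed

end

section \<open>The stabilizer of a maximal ideal\<close>

locale graded_simple_with_maximal_ideal = finite_graded_simple_lie_algebra K L Q D
  for K :: "('k, 'n) ring_scheme" (structure) and L :: "('k, 'a, 'm) lie_algebra_scheme" (structure)
    and Q :: "('q, 'p) monoid_scheme" and D +
  fixes \<Xi> :: "('q \<Rightarrow> 'k) set" and I :: "'a set"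
  assumes characters: "separating_character_group Q (Multiplicative_Group.mult_of K) \<Xi>"
    and maximal: "maximal_lie_ideal I K L"
begin

lemma
  shows finite_characters: "finite \<Xi>"
    and character_one: "\<exists>\<epsilon> \<in> \<Xi>. \<forall>\<alpha> \<in> carrier Q. \<epsilon> \<alpha> = \<one>"
    and character_product: "\<chi> \<in> \<Xi> \<Longrightarrow> \<psi> \<in> \<Xi> \<Longrightarrow> \<exists>\<theta> \<in> \<Xi>. \<forall>\<alpha> \<in> carrier Q. \<theta> \<alpha> = \<chi> \<alpha> \<otimes> \<psi> \<alpha>"
    and character_inverse: "\<chi> \<in> \<Xi> \<Longrightarrow> \<exists>\<psi> \<in> \<Xi>. \<forall>\<alpha> \<in> carrier Q. \<chi> \<alpha> \<otimes> \<psi> \<alpha> = \<one>"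
    and characters_separating:
      "\<alpha> \<in> carrier Q \<Longrightarrow> \<beta> \<in> carrier Q \<Longrightarrow> \<alpha> \<noteq> \<beta> \<Longrightarrow> \<exists>\<chi> \<in> \<Xi>. \<chi> \<alpha> \<noteq> \<chi> \<beta>"
  using characters by (simp_all add: separating_character_group_def)

lemma
  assumes "\<chi> \<in> \<Xi>"
  shows character_closed [simp]: "\<alpha> \<in> carrier Q \<Longrightarrow> \<chi> \<alpha> \<in> carrier K"
    and character_nonzero [simp]: "\<alpha> \<in> carrier Q \<Longrightarrow> \<chi> \<alpha> \<noteq> \<zero>"
    and character_funcset [simp]: "\<chi> \<in> carrier Q \<rightarrow> carrier K"
    and character_mult: "\<alpha> \<in> carrier Q \<Longrightarrow> \<beta> \<in> carrier Q \<Longrightarrow> \<chi> (\<alpha> \<otimes>\<^bsub>Q\<^esub> \<beta>) = \<chi> \<alpha> \<otimes> \<chi> \<beta>"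
proof -
  have \<chi>: "\<chi> \<in> hom Q (Multiplicative_Group.mult_of K)" using characters assms by (auto simp: separating_character_group_def)
  show closed: "\<chi> \<alpha> \<in> carrier K" "\<chi> \<alpha> \<noteq> \<zero>" if "\<alpha> \<in> carrier Q" for \<alpha>
    using hom_in_carrier[OF \<chi> that] by simp_all
  then show "\<chi> \<in> carrier Q \<rightarrow> carrier K" by simp
  show "\<alpha> \<in> carrier Q \<Longrightarrow> \<beta> \<in> carrier Q \<Longrightarrow> \<chi> (\<alpha> \<otimes>\<^bsub>Q\<^esub> \<beta>) = \<chi> \<alpha> \<otimes> \<chi> \<beta>"
    using hom_mult[OF \<chi>] by simp
qed

lemma character_Q_one: "\<chi> \<in> \<Xi> \<Longrightarrow> \<chi> \<one>\<^bsub>Q\<^esub> = \<one>"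
  using character_mult[of \<chi> "\<one>\<^bsub>Q\<^esub>" "\<one>\<^bsub>Q\<^esub>"] character_nonzero[of \<chi> "\<one>\<^bsub>Q\<^esub>"]
    character_closed[of \<chi> "\<one>\<^bsub>Q\<^esub>"] R.m_comm m_rcancel[of "\<chi> \<one>\<^bsub>Q\<^esub>" "\<chi> \<one>\<^bsub>Q\<^esub>" \<one>] by simp

lemma act_inverse:
  assumes "\<chi> \<in> \<Xi>" "\<psi> \<in> \<Xi>" "\<forall>\<alpha> \<in> carrier Q. \<chi> \<alpha> \<otimes> \<psi> \<alpha> = \<one>" "x \<in> carrier L"
  shows "act \<chi> (act \<psi> x) = x" "act \<psi> (act \<chi> x) = x"
proof -
  have "act \<chi> (act \<psi> x) = act (\<lambda>_. \<one>) x" "act \<psi> (act \<chi> x) = act (\<lambda>_. \<one>) x"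
    using assms by (auto intro!: act_act simp: R.m_comm[of "\<psi> _" "\<chi> _"])
  then show "act \<chi> (act \<psi> x) = x" "act \<psi> (act \<chi> x) = x"
    using assms(4) act_one[of x "\<lambda>_. \<one>"] by simp_all
qed

text \<open>This is the translate of \<open>J\<close> by the inverse character; as characters act by automorphisms, the
  translates of \<open>I\<close> are maximal ideals as well.\<close>
definition pullback :: "('q \<Rightarrow> 'k) \<Rightarrow> 'a set \<Rightarrow> 'a set" where
  "pullback \<chi> J = {x \<in> carrier L. act \<chi> x \<in> J}"

lemma lie_ideal_pullback:
  assumes "\<chi> \<in> \<Xi>" "lie_ideal J K L"
  shows "lie_ideal (pullback \<chi> J) K L"
  by (rule lie_idealI)
    (use assms in \<open>auto simp: pullback_def act_zero act_add act_smult bracket_closed act_bracket character_mult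
      lie_ideal_zero lie_ideal_add lie_ideal_smult lie_ideal_bracket\<close>)

lemma I_ideal: "lie_ideal I K L" and I_proper: "I \<noteq> carrier L"
  using maximal by (simp_all add: maximal_lie_ideal_def)

lemma maximal_lie_ideal_pullback:
  assumes \<chi>: "\<chi> \<in> \<Xi>"
  shows "maximal_lie_ideal (pullback \<chi> I) K L"
  unfolding maximal_lie_ideal_def
proof (intro conjI allI impI)
  obtain \<psi> where \<psi>: "\<psi> \<in> \<Xi>" "\<forall>\<alpha> \<in> carrier Q. \<chi> \<alpha> \<otimes> \<psi> \<alpha> = \<one>" using character_inverse[OF \<chi>] by blast
  note inverse = act_inverse[OF \<chi> \<psi>]
  show "lie_ideal (pullback \<chi> I) K L" by (rule lie_ideal_pullback[OF \<chi> I_ideal])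
  show "pullback \<chi> I \<noteq> carrier L"
  proof
    assume all: "pullback \<chi> I = carrier L"
    have "x \<in> I" if "x \<in> carrier L" for x
    proof -
      have "act \<psi> x \<in> pullback \<chi> I" using all \<psi>(1) that by simp
      then show ?thesis using inverse(1)[OF that] by (simp add: pullback_def)
    qed
    then show False using I_proper lie_ideal_carrier[OF I_ideal] by blast
  qed
  fix J assume J: "lie_ideal J K L" "pullback \<chi> I \<subseteq> J"
  have "x \<in> pullback \<psi> J" if "x \<in> I" for x
  proof -
    have x: "x \<in> carrier L" using that lie_ideal_carrier[OF I_ideal] by blast
    then have "act \<psi> x \<in> pullback \<chi> I" using that \<psi>(1) inverse(1)[OF x] by (simp add: pullback_def)
    then show ?thesis using J(2) x by (auto simp: pullback_def)
  qed
  then have "pullback \<psi> J = I \<or> pullback \<psi> J = carrier L"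
    using maximal lie_ideal_pullback[OF \<psi>(1) J(1)] unfolding maximal_lie_ideal_def by blast
  moreover have "x \<in> J \<longleftrightarrow> act \<chi> x \<in> pullback \<psi> J" if "x \<in> carrier L" for x
    using that \<chi> inverse(2)[OF that] by (simp add: pullback_def)
  then have "J = {x \<in> carrier L. act \<chi> x \<in> pullback \<psi> J}" using lie_ideal_carrier[OF J(1)] by blast
  moreover have "{x \<in> carrier L. act \<chi> x \<in> carrier L} = carrier L" using \<chi> by auto
  ultimately show "J = pullback \<chi> I \<or> J = carrier L" by (metis pullback_def)
qed

definition stabilizer :: "('q \<Rightarrow> 'k) set" where
  "stabilizer = {\<chi> \<in> \<Xi>. pullback \<chi> I = I}"

text \<open>The annihilator of the stabilizer: degrees are separated by the stabilizer precisely when they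
  differ modulo \<open>P\<close>, so the action of the stabilizer on the quotient by \<open>I\<close> amounts to a grading
  by \<open>Q / P\<close>.\<close>
definition P :: "'q set" where
  "P = {\<alpha> \<in> carrier Q. \<forall>\<chi> \<in> stabilizer. \<chi> \<alpha> = \<one>}"

lemma subgroup_P: "subgroup P Q"
proof (rule Q.subgroupI)
  have "\<one>\<^bsub>Q\<^esub> \<in> P" by (simp add: P_def stabilizer_def character_Q_one)
  then show "P \<noteq> {}" by blast
  show "inv\<^bsub>Q\<^esub> \<alpha> \<in> P" if \<alpha>: "\<alpha> \<in> P" for \<alpha>
  proof -
    have "\<chi> (inv\<^bsub>Q\<^esub> \<alpha>) = \<one>" if "\<chi> \<in> stabilizer" for \<chi>
    proof -
      have \<chi>: "\<chi> \<in> \<Xi>" and "\<alpha> \<in> carrier Q" "\<chi> \<alpha> = \<one>" using that \<alpha> by (auto simp: P_def stabilizer_def)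
      then show ?thesis
        using character_mult[OF \<chi>, of "inv\<^bsub>Q\<^esub> \<alpha>" \<alpha>] character_Q_one[OF \<chi>] by simp
    qed
    then show ?thesis using \<alpha> by (simp add: P_def)
  qed
  show "\<alpha> \<otimes>\<^bsub>Q\<^esub> \<beta> \<in> P" if "\<alpha> \<in> P" "\<beta> \<in> P" for \<alpha> \<beta>
  proof -
    have "\<chi> (\<alpha> \<otimes>\<^bsub>Q\<^esub> \<beta>) = \<one>" if "\<chi> \<in> stabilizer" for \<chi>
    proof -
      have "\<chi> \<in> \<Xi>" "\<alpha> \<in> carrier Q" "\<chi> \<alpha> = \<one>" "\<beta> \<in> carrier Q" "\<chi> \<beta> = \<one>"
        using that \<open>\<alpha> \<in> P\<close> \<open>\<beta> \<in> P\<close> by (auto simp: P_def stabilizer_def)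
      then show ?thesis using character_mult[of \<chi> \<alpha> \<beta>] by simp
    qed
    then show ?thesis using that by (simp add: P_def)
  qed
qed (auto simp: P_def)

lemma stabilizer_separates_cosets:
  assumes "\<alpha> \<in> carrier Q" "\<beta> \<in> carrier Q" "P #>\<^bsub>Q\<^esub> \<alpha> \<noteq> P #>\<^bsub>Q\<^esub> \<beta>"
  shows "\<exists>\<chi> \<in> stabilizer. \<chi> \<alpha> \<noteq> \<chi> \<beta>"
proof -
  define \<gamma> where "\<gamma> = \<alpha> \<otimes>\<^bsub>Q\<^esub> inv\<^bsub>Q\<^esub> \<beta>"
  have \<gamma>: "\<gamma> \<in> carrier Q" "\<alpha> = \<gamma> \<otimes>\<^bsub>Q\<^esub> \<beta>" using assms by (simp_all add: \<gamma>_def Q.m_assoc)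
  have "\<gamma> \<notin> P"
  proof
    assume "\<gamma> \<in> P"
    then have "\<alpha> \<in> P #>\<^bsub>Q\<^esub> \<beta>" using \<gamma>(2) by (auto simp: r_coset_def)
    then show False using Q.repr_independence[OF _ assms(2) subgroup_P] assms(3) by blast
  qed
  then obtain \<chi> where \<chi>: "\<chi> \<in> stabilizer" "\<chi> \<gamma> \<noteq> \<one>" using \<gamma>(1) by (auto simp: P_def)
  then have \<chi>': "\<chi> \<in> \<Xi>" by (simp add: stabilizer_def)
  have "\<chi> \<alpha> = \<chi> \<gamma> \<otimes> \<chi> \<beta>" using character_mult[OF \<chi>' \<gamma>(1) assms(2)] \<gamma>(2) by simp
  then have "\<chi> \<alpha> \<noteq> \<chi> \<beta>"
    using \<chi>(2) \<chi>' \<gamma>(1) assms(2) m_rcancel[of "\<chi> \<beta>" "\<chi> \<gamma>" \<one>] by simp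
  then show ?thesis using \<chi>(1) by blast
qed

text \<open>Since the stabilizer separates the cosets of \<open>P\<close>, it separates the degrees in the support; this
  makes the sum of the components of the quotient direct.\<close>
lemma support_in_transversal_imp_zero:
  assumes "z \<in> I"
    and "\<And>\<alpha> \<beta>. \<lbrakk>\<alpha> \<in> carrier Q; \<beta> \<in> carrier Q; \<alpha> \<noteq> \<beta>; component \<alpha> z \<noteq> \<zero>\<^bsub>L\<^esub>;
      component \<beta> z \<noteq> \<zero>\<^bsub>L\<^esub>\<rbrakk> \<Longrightarrow> P #>\<^bsub>Q\<^esub> \<alpha> \<noteq> P #>\<^bsub>Q\<^esub> \<beta>"
  shows "z = \<zero>\<^bsub>L\<^esub>"
proof (rule separated_support_imp_zero[OF lie_ideal_submodule[OF I_ideal], of stabilizer])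
  show "stabilizer \<subseteq> carrier Q \<rightarrow> carrier K" using character_funcset by (auto simp: stabilizer_def)
  show "act \<chi> x \<in> I" if "\<chi> \<in> stabilizer" "x \<in> I" for \<chi> x
    using that by (auto simp: stabilizer_def pullback_def)
  show "x = \<zero>\<^bsub>L\<^esub>" if "\<alpha> \<in> carrier Q" "x \<in> D \<alpha>" "x \<in> I" for \<alpha> x
    using homogeneous_in_proper_ideal[OF I_ideal I_proper that] .
  show "\<exists>\<chi> \<in> stabilizer. \<chi> \<alpha> \<noteq> \<chi> \<beta>"
    if "\<alpha> \<in> carrier Q" "\<beta> \<in> carrier Q" "\<alpha> \<noteq> \<beta>" "component \<alpha> z \<noteq> \<zero>\<^bsub>L\<^esub>" "component \<beta> z \<noteq> \<zero>\<^bsub>L\<^esub>" for \<alpha> \<beta>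
    by (rule stabilizer_separates_cosets[OF that(1,2) assms(2)[OF that]])
qed (rule assms(1))

text \<open>The intersection of all translates of \<open>I\<close> is an ideal that is invariant under all characters and,
  being contained in \<open>I\<close>, has no nonzero homogeneous elements.\<close>
lemma Inter_pullbacks_eq_zero:
  assumes z: "z \<in> carrier L" "\<And>\<chi>. \<chi> \<in> \<Xi> \<Longrightarrow> act \<chi> z \<in> I"
  shows "z = \<zero>\<^bsub>L\<^esub>"
proof -
  define N where "N = {x \<in> carrier L. \<forall>\<chi> \<in> \<Xi>. x \<in> pullback \<chi> I}"
  have N: "lie_ideal N K L" unfolding N_def using lie_ideal_pullback I_ideal by (intro lie_ideal_Inter)
  obtain \<epsilon> where \<epsilon>: "\<epsilon> \<in> \<Xi>" "\<forall>\<alpha> \<in> carrier Q. \<epsilon> \<alpha> = \<one>" using character_one by blast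
  show ?thesis
  proof (rule separated_support_imp_zero[OF lie_ideal_submodule[OF N], of \<Xi>])
    show "act \<psi> x \<in> N" if \<psi>: "\<psi> \<in> \<Xi>" and x: "x \<in> N" for \<psi> x
    proof -
      have xL: "x \<in> carrier L" using x by (simp add: N_def)
      have "act \<chi> (act \<psi> x) \<in> I" if \<chi>: "\<chi> \<in> \<Xi>" for \<chi>
      proof -
        obtain \<theta> where \<theta>: "\<theta> \<in> \<Xi>" "\<forall>\<alpha> \<in> carrier Q. \<theta> \<alpha> = \<chi> \<alpha> \<otimes> \<psi> \<alpha>"
          using character_product[OF \<chi> \<psi>] by blast
        then have "act \<chi> (act \<psi> x) = act \<theta> x" using \<chi> \<psi> xL by (intro act_act) simp_all
        then show ?thesis using x \<theta>(1) by (simp add: N_def pullback_def)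
      qed
      then show ?thesis using \<psi> xL by (simp add: N_def pullback_def)
    qed
    show "x = \<zero>\<^bsub>L\<^esub>" if x: "\<alpha> \<in> carrier Q" "x \<in> D \<alpha>" "x \<in> N" for \<alpha> x
    proof -
      have "act \<epsilon> x = x" using D_closed[OF x(1,2)] \<epsilon>(2) by (intro act_one) simp_all
      then have "x \<in> I" using x(3) \<epsilon>(1) by (auto simp: N_def pullback_def)
      then show ?thesis using homogeneous_in_proper_ideal[OF I_ideal I_proper x(1,2)] by blast
    qed
    show "z \<in> N" using z by (simp add: N_def pullback_def)
  qed (use characters_separating character_funcset in blast)+
qed

text \<open>The Chinese remainder theorem gives \<open>y\<close> with \<open>y \<equiv> \<chi>(p)\<^sup>-\<^sup>1 x\<close> modulo the pullback of \<open>I\<close> under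
  \<open>\<chi>\<close>, for each \<open>\<chi>\<close>. Since \<open>\<chi> x = \<chi>(p) \<chi>(\<alpha>) x\<close>, this means \<open>\<chi> y \<equiv> \<chi>(\<alpha>) x\<close> modulo \<open>I\<close>, the
  congruence that an element of degree \<open>\<alpha>\<close> congruent to \<open>x\<close> must satisfy. The prescribed residues are
  compatible: if two characters have the same pullback of \<open>I\<close>, their quotient stabilizes \<open>I\<close> and is
  trivial on \<open>p\<close>.\<close>
lemma homogeneous_representative:
  assumes \<alpha>: "\<alpha> \<in> carrier Q" and p: "p \<in> P" and x: "x \<in> D (p \<otimes>\<^bsub>Q\<^esub> \<alpha>)"
  shows "\<exists>y \<in> D \<alpha>. y \<ominus>\<^bsub>L\<^esub> x \<in> I"
proof -
  have pQ: "p \<in> carrier Q" using p by (simp add: P_def)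
  have xL: "x \<in> carrier L" using x \<alpha> pQ D_closed by blast
  have inv_K: "inv c \<in> carrier K" "c \<otimes> inv c = \<one>" if "c \<in> carrier K" "c \<noteq> \<zero>" for c
    using that field_Units by auto
  have same_p: "\<chi> p = \<psi> p" if \<chi>: "\<chi> \<in> \<Xi>" and \<psi>: "\<psi> \<in> \<Xi>" and eq: "pullback \<chi> I = pullback \<psi> I" for \<chi> \<psi>
  proof -
    obtain \<psi>' where \<psi>': "\<psi>' \<in> \<Xi>" "\<forall>\<alpha> \<in> carrier Q. \<psi> \<alpha> \<otimes> \<psi>' \<alpha> = \<one>" using character_inverse[OF \<psi>] by blast
    obtain \<theta> where \<theta>: "\<theta> \<in> \<Xi>" "\<forall>\<alpha> \<in> carrier Q. \<theta> \<alpha> = \<chi> \<alpha> \<otimes> \<psi>' \<alpha>"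
      using character_product[OF \<chi> \<psi>'(1)] by blast
    have "act \<theta> y \<in> I \<longleftrightarrow> y \<in> I" if y: "y \<in> carrier L" for y
    proof -
      have "act \<theta> y = act \<chi> (act \<psi>' y)" using \<theta> \<chi> \<psi>'(1) y by (intro act_act[symmetric]) simp_all
      then have "act \<theta> y \<in> I \<longleftrightarrow> act \<psi>' y \<in> pullback \<chi> I" using \<psi>'(1) y by (simp add: pullback_def)
      also have "\<dots> \<longleftrightarrow> y \<in> I"
        unfolding eq using \<psi>'(1) y act_inverse(1)[OF \<psi> \<psi>' y] by (simp add: pullback_def)
      finally show ?thesis .
    qed
    then have "\<theta> \<in> stabilizer"
      using \<theta>(1) lie_ideal_carrier[OF I_ideal] by (auto simp: stabilizer_def pullback_def)
    then have "\<chi> p \<otimes> \<psi>' p = \<psi> p \<otimes> \<psi>' p" using p pQ \<theta>(2) \<psi>'(2) by (auto simp: P_def)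
    then show ?thesis using \<chi> \<psi> \<psi>'(1) pQ m_rcancel[of "\<psi>' p" "\<chi> p" "\<psi> p"] by simp
  qed
  have "\<exists>y \<in> carrier L. \<forall>\<chi> \<in> \<Xi>. y \<ominus>\<^bsub>L\<^esub> inv (\<chi> p) \<odot>\<^bsub>L\<^esub> x \<in> pullback \<chi> I"
  proof (rule chinese_remainder_maximal_lie_ideals[OF perfect finite_characters maximal_lie_ideal_pullback])
    show "inv (\<chi> p) \<odot>\<^bsub>L\<^esub> x \<in> carrier L" if "\<chi> \<in> \<Xi>" for \<chi>
      using that xL pQ inv_K(1)[of "\<chi> p"] by simp
    show "inv (\<chi> p) \<odot>\<^bsub>L\<^esub> x = inv (\<psi> p) \<odot>\<^bsub>L\<^esub> x"
      if "\<chi> \<in> \<Xi>" "\<psi> \<in> \<Xi>" "pullback \<chi> I = pullback \<psi> I" for \<chi> \<psi>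
      using same_p[OF that] by simp
  qed
  then obtain y where y: "y \<in> carrier L"
    and y_cong: "\<And>\<chi>. \<chi> \<in> \<Xi> \<Longrightarrow> y \<ominus>\<^bsub>L\<^esub> inv (\<chi> p) \<odot>\<^bsub>L\<^esub> x \<in> pullback \<chi> I" by blast
  have act_y: "act \<chi> y \<ominus>\<^bsub>L\<^esub> \<chi> \<alpha> \<odot>\<^bsub>L\<^esub> x \<in> I" if \<chi>: "\<chi> \<in> \<Xi>" for \<chi>
  proof -
    have c: "\<chi> p \<in> carrier K" "\<chi> \<alpha> \<in> carrier K" "inv (\<chi> p) \<in> carrier K" "inv (\<chi> p) \<otimes> \<chi> p = \<one>"
      using \<chi> \<alpha> pQ inv_K[of "\<chi> p"] R.m_comm[of "\<chi> p" "inv (\<chi> p)"] by simp_all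
    have "inv (\<chi> p) \<otimes> (\<chi> p \<otimes> \<chi> \<alpha>) = \<chi> \<alpha>" using c by (simp flip: R.m_assoc)
    moreover have "act \<chi> (inv (\<chi> p) \<odot>\<^bsub>L\<^esub> x) = inv (\<chi> p) \<odot>\<^bsub>L\<^esub> ((\<chi> p \<otimes> \<chi> \<alpha>) \<odot>\<^bsub>L\<^esub> x)"
      using \<chi> x xL \<alpha> pQ c by (simp add: act_smult act_homogeneous character_mult)
    ultimately have "act \<chi> (inv (\<chi> p) \<odot>\<^bsub>L\<^esub> x) = \<chi> \<alpha> \<odot>\<^bsub>L\<^esub> x" using c xL by (simp flip: smult_assoc1)
    then show ?thesis using y_cong[OF \<chi>] \<chi> y xL c by (simp add: pullback_def act_minus)
  qed
  \<comment> \<open>by \<open>act_y\<close> at \<open>\<chi>\<psi>\<close> and at \<open>\<chi>\<close>, both sides agree modulo \<open>I\<close> after applying any \<open>\<chi>\<close>\<close>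
  have eigen: "act \<psi> y = \<psi> \<alpha> \<odot>\<^bsub>L\<^esub> y" if \<psi>: "\<psi> \<in> \<Xi>" for \<psi>
  proof -
    have "act \<psi> y \<ominus>\<^bsub>L\<^esub> \<psi> \<alpha> \<odot>\<^bsub>L\<^esub> y = \<zero>\<^bsub>L\<^esub>"
    proof (rule Inter_pullbacks_eq_zero)
      fix \<chi> assume \<chi>: "\<chi> \<in> \<Xi>"
      obtain \<theta> where \<theta>: "\<theta> \<in> \<Xi>" "\<forall>\<beta> \<in> carrier Q. \<theta> \<beta> = \<psi> \<beta> \<otimes> \<chi> \<beta>"
        using character_product[OF \<psi> \<chi>] by blast
      have c: "\<chi> \<alpha> \<in> carrier K" "\<psi> \<alpha> \<in> carrier K" using \<chi> \<psi> \<alpha> by simp_all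
      have "act \<chi> (act \<psi> y) = act \<theta> y" using \<chi> \<psi> \<theta>(2) y by (intro act_act) (simp_all add: R.m_comm)
      then have "act \<chi> (act \<psi> y \<ominus>\<^bsub>L\<^esub> \<psi> \<alpha> \<odot>\<^bsub>L\<^esub> y) = act \<theta> y \<ominus>\<^bsub>L\<^esub> \<psi> \<alpha> \<odot>\<^bsub>L\<^esub> act \<chi> y"
        using \<chi> \<psi> y c by (simp add: act_minus act_smult)
      also have "\<dots> = (act \<theta> y \<ominus>\<^bsub>L\<^esub> \<theta> \<alpha> \<odot>\<^bsub>L\<^esub> x) \<ominus>\<^bsub>L\<^esub> \<psi> \<alpha> \<odot>\<^bsub>L\<^esub> (act \<chi> y \<ominus>\<^bsub>L\<^esub> \<chi> \<alpha> \<odot>\<^bsub>L\<^esub> x)"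
      proof -
        have "\<theta> \<alpha> \<odot>\<^bsub>L\<^esub> x = \<psi> \<alpha> \<odot>\<^bsub>L\<^esub> (\<chi> \<alpha> \<odot>\<^bsub>L\<^esub> x)" using \<theta>(2) \<alpha> c xL by (simp add: smult_assoc1)
        then show ?thesis
          using \<chi> \<theta>(1) y xL c
          by (simp add: a_minus_def smult_r_distr smult_r_minus M.minus_add M.a_ac M.r_neg1 M.r_neg2 M.r_neg)
      qed
      also have "\<dots> \<in> I"
        by (rule lie_ideal_minus[OF I_ideal act_y[OF \<theta>(1)] lie_ideal_smult[OF I_ideal c(2) act_y[OF \<chi>]]])
      finally show "act \<chi> (act \<psi> y \<ominus>\<^bsub>L\<^esub> \<psi> \<alpha> \<odot>\<^bsub>L\<^esub> y) \<in> I" .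
    qed (use \<psi> y \<alpha> in simp)
    then show ?thesis using \<psi> y \<alpha> by (simp add: diff_eq_zero_iff)
  qed
  have "y = component \<alpha> y"
  proof (rule component_eqI)
    fix \<beta> assume \<beta>: "\<beta> \<in> carrier Q"
    have "component \<beta> y = \<zero>\<^bsub>L\<^esub>" if neq: "\<beta> \<noteq> \<alpha>"
    proof -
      obtain \<psi> where \<psi>: "\<psi> \<in> \<Xi>" "\<psi> \<beta> \<noteq> \<psi> \<alpha>" using characters_separating[OF \<beta> \<alpha> neq] by blast
      have "\<psi> \<beta> \<odot>\<^bsub>L\<^esub> component \<beta> y = \<psi> \<alpha> \<odot>\<^bsub>L\<^esub> component \<beta> y"
        using eigen[OF \<psi>(1)] component_act[of \<psi> y \<beta>] \<psi>(1) y \<alpha> \<beta> by (simp add: component_smult)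
      then show ?thesis using smult_eq_imp_zero[of "\<psi> \<beta>" "\<psi> \<alpha>"] \<psi> y \<alpha> \<beta> by simp
    qed
    then show "component \<beta> y = component \<beta> (component \<alpha> y)"
      using component_homogeneous[OF component_in_D[OF y \<alpha>] \<alpha> \<beta>] by simp
  qed (use y \<alpha> in simp_all)
  then have "y \<in> D \<alpha>" using component_in_D[OF y \<alpha>] by simp
  moreover obtain \<epsilon> where \<epsilon>: "\<epsilon> \<in> \<Xi>" "\<forall>\<alpha> \<in> carrier Q. \<epsilon> \<alpha> = \<one>" using character_one by blast
  then have "y \<ominus>\<^bsub>L\<^esub> x \<in> I" using act_y[OF \<epsilon>(1)] act_one[OF y, of \<epsilon>] \<alpha> xL by simp
  ultimately show ?thesis by blast
qed

end

section \<open>The grading of the simple quotient\<close>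

locale graded_simple_quotient =
  graded_simple_with_maximal_ideal K L Q D \<Xi> I + lie_epimorphism K L A \<pi>
  for K :: "('k, 'n) ring_scheme" (structure) and L :: "('k, 'a, 'm) lie_algebra_scheme" (structure)
    and Q :: "('q, 'p) monoid_scheme" and D \<Xi> I
    and A :: "('k, 'b, 'l) lie_algebra_scheme" and \<pi> +
  assumes kernel: "{x \<in> carrier L. \<pi> x = \<zero>\<^bsub>A\<^esub>} = I"
begin

lemma \<pi>_eq_iff: "x \<in> carrier L \<Longrightarrow> y \<in> carrier L \<Longrightarrow> \<pi> x = \<pi> y \<longleftrightarrow> x \<ominus>\<^bsub>L\<^esub> y \<in> I"
  unfolding kernel[symmetric] by (simp add: \<pi>_minus A.diff_eq_zero_iff)

lemma inj_on_D: "\<alpha> \<in> carrier Q \<Longrightarrow> inj_on \<pi> (D \<alpha>)"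
proof (rule inj_onI)
  fix x y assume \<alpha>: "\<alpha> \<in> carrier Q" and xy: "x \<in> D \<alpha>" "y \<in> D \<alpha>" "\<pi> x = \<pi> y"
  then have "x \<ominus>\<^bsub>L\<^esub> y \<in> D \<alpha>" "x \<ominus>\<^bsub>L\<^esub> y \<in> I"
    using submodule_minus_closed[OF D_submodule[OF \<alpha>]] D_closed \<pi>_eq_iff by auto
  then have "x \<ominus>\<^bsub>L\<^esub> y = \<zero>\<^bsub>L\<^esub>" using homogeneous_in_proper_ideal[OF I_ideal I_proper \<alpha>] by blast
  then show "x = y" using xy \<alpha> D_closed diff_eq_zero_iff by blast
qed

lemma \<pi>_finsum: "(\<And>i. i \<in> S \<Longrightarrow> f i \<in> carrier L) \<Longrightarrow> \<pi> (finsum L f S) = finsum A (\<lambda>i. \<pi> (f i)) S"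
  by (intro finsum_additive M.abelian_group_axioms A.M.abelian_group_axioms) (simp_all add: \<pi>_add)

text \<open>This is where surjectivity onto the loop algebra comes from: each homogeneous component of the
  quotient is already the image of a single component of \<open>L\<close>, of any degree in the coset.\<close>
lemma image_D_subset:
  assumes "\<alpha> \<in> carrier Q" "\<beta> \<in> carrier Q" "P #>\<^bsub>Q\<^esub> \<alpha> = P #>\<^bsub>Q\<^esub> \<beta>"
  shows "\<pi> ` D \<beta> \<subseteq> \<pi> ` D \<alpha>"
proof
  fix z assume "z \<in> \<pi> ` D \<beta>"
  then obtain x where x: "x \<in> D \<beta>" "z = \<pi> x" by blast
  have "\<beta> \<in> P #>\<^bsub>Q\<^esub> \<alpha>" using Q.repr_independenceD[OF subgroup_P assms(2,3)] .
  then obtain p where p: "p \<in> P" "\<beta> = p \<otimes>\<^bsub>Q\<^esub> \<alpha>" by (auto simp: r_coset_def)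
  then obtain y where "y \<in> D \<alpha>" "y \<ominus>\<^bsub>L\<^esub> x \<in> I" using homogeneous_representative[OF assms(1) p(1)] x(1) by blast
  then have "y \<in> D \<alpha>" "\<pi> y = \<pi> x" using \<pi>_eq_iff x(1) D_closed assms by auto
  then show "z \<in> \<pi> ` D \<alpha>" using x(2) by (metis image_eqI)
qed

text \<open>By \<open>image_D_subset\<close> the choice of the representative is immaterial.\<close>
definition E :: "'q set \<Rightarrow> 'b set" where
  "E C = \<pi> ` D (SOME \<alpha>. \<alpha> \<in> C)"

lemma coset_representative:
  assumes "C \<in> rcosets\<^bsub>Q\<^esub> P"
  shows "(SOME \<alpha>. \<alpha> \<in> C) \<in> carrier Q" "P #>\<^bsub>Q\<^esub> (SOME \<alpha>. \<alpha> \<in> C) = C"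
proof -
  obtain \<beta> where \<beta>: "\<beta> \<in> carrier Q" "C = P #>\<^bsub>Q\<^esub> \<beta>" using assms by (auto simp: RCOSETS_def)
  then have "\<beta> \<in> C" using Q.rcos_self[OF _ subgroup_P] by simp
  then have in_C: "(SOME \<alpha>. \<alpha> \<in> C) \<in> C" by (rule someI)
  then show "(SOME \<alpha>. \<alpha> \<in> C) \<in> carrier Q"
    using \<beta> Q.r_coset_subset_G[of P \<beta>] subgroup.subset[OF subgroup_P] by blast
  show "P #>\<^bsub>Q\<^esub> (SOME \<alpha>. \<alpha> \<in> C) = C"
    using in_C \<beta> Q.repr_independence[OF _ \<beta>(1) subgroup_P] by blast
qed

lemma coset_in_rcosets: "\<alpha> \<in> carrier Q \<Longrightarrow> P #>\<^bsub>Q\<^esub> \<alpha> \<in> rcosets\<^bsub>Q\<^esub> P"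
  using Q.rcosetsI subgroup.subset[OF subgroup_P] by blast

lemma E_coset: "\<alpha> \<in> carrier Q \<Longrightarrow> E (P #>\<^bsub>Q\<^esub> \<alpha>) = \<pi> ` D \<alpha>"
  unfolding E_def
  using image_D_subset coset_representative[OF coset_in_rcosets, of \<alpha>] by (intro equalityI) simp_all

lemma submodule_E:
  assumes "C \<in> rcosets\<^bsub>Q\<^esub> P"
  shows "submodule (E C) K A"
proof -
  define \<alpha> where "\<alpha> = (SOME \<alpha>. \<alpha> \<in> C)"
  have \<alpha>: "\<alpha> \<in> carrier Q" using coset_representative(1)[OF assms] by (simp add: \<alpha>_def)
  have E: "E C = \<pi> ` D \<alpha>" by (simp add: E_def \<alpha>_def)
  show ?thesis
  proof (rule A.submoduleI)
    show "E C \<subseteq> carrier A" using E D_closed[OF \<alpha>] by auto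
    show "\<zero>\<^bsub>A\<^esub> \<in> E C" using E D_zero[OF \<alpha>] \<pi>_zero by force
    show smult: "c \<odot>\<^bsub>A\<^esub> x \<in> E C" if "c \<in> carrier K" "x \<in> E C" for c x
      using that D_closed[OF \<alpha>] D_smult[OF \<alpha>] by (auto simp: E simp flip: \<pi>_smult)
    then show "\<ominus>\<^bsub>A\<^esub> x \<in> E C" if "x \<in> E C" for x
      using smult[of "\<ominus> \<one>" x] that A.minus_smult[of x] D_closed[OF \<alpha>] by (auto simp: E)
    show "x \<oplus>\<^bsub>A\<^esub> y \<in> E C" if "x \<in> E C" "y \<in> E C" for x y
      using that D_closed[OF \<alpha>] D_add[OF \<alpha>] by (auto simp: E simp flip: \<pi>_add)
  qed
qed

lemma finite_rcosets: "finite (rcosets\<^bsub>Q\<^esub> P)"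
  using finite_Q by (simp add: RCOSETS_def)

text \<open>A sum of homogeneous elements, one for the chosen representative of each coset, has no other
  components. So such sums have supports to which \<open>support_in_transversal_imp_zero\<close> applies.\<close>
lemma component_finsum_transversal:
  assumes t: "\<And>C. C \<in> rcosets\<^bsub>Q\<^esub> P \<Longrightarrow> t C \<in> D (SOME \<alpha>. \<alpha> \<in> C)" and \<alpha>: "\<alpha> \<in> carrier Q"
  shows "component \<alpha> (finsum L t (rcosets\<^bsub>Q\<^esub> P)) =
    (if \<alpha> = (SOME \<beta>. \<beta> \<in> P #>\<^bsub>Q\<^esub> \<alpha>) then t (P #>\<^bsub>Q\<^esub> \<alpha>) else \<zero>\<^bsub>L\<^esub>)"
proof -
  let ?C = "P #>\<^bsub>Q\<^esub> \<alpha>"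
  have tL: "t C \<in> carrier L" if "C \<in> rcosets\<^bsub>Q\<^esub> P" for C
    using t[OF that] coset_representative(1)[OF that] D_closed by blast
  have comp: "component \<alpha> (t C) = (if \<alpha> = (SOME \<beta>. \<beta> \<in> C) then t C else \<zero>\<^bsub>L\<^esub>)" if "C \<in> rcosets\<^bsub>Q\<^esub> P" for C
    using component_homogeneous[OF t[OF that] coset_representative(1)[OF that] \<alpha>] .
  have other: "\<alpha> \<noteq> (SOME \<beta>. \<beta> \<in> C)" if "C \<in> rcosets\<^bsub>Q\<^esub> P" "C \<noteq> ?C" for C
    using coset_representative(2)[OF that(1)] that(2) by auto
  let ?v = "if \<alpha> = (SOME \<beta>. \<beta> \<in> ?C) then t ?C else \<zero>\<^bsub>L\<^esub>"
  have v: "?v \<in> carrier L" using tL coset_in_rcosets[OF \<alpha>] by simp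
  have "component \<alpha> (finsum L t (rcosets\<^bsub>Q\<^esub> P)) = finsum L (\<lambda>C. component \<alpha> (t C)) (rcosets\<^bsub>Q\<^esub> P)"
    using tL \<alpha> by (intro finsum_additive[of L L] M.abelian_group_axioms) (simp_all add: component_add)
  also have "\<dots> = finsum L (\<lambda>C. if C = ?C then ?v else \<zero>\<^bsub>L\<^esub>) (rcosets\<^bsub>Q\<^esub> P)"
  proof (rule M.finsum_cong')
    show "component \<alpha> (t C) = (if C = ?C then ?v else \<zero>\<^bsub>L\<^esub>)" if "C \<in> rcosets\<^bsub>Q\<^esub> P" for C
      using comp[OF that] other[OF that] by auto
  qed (use v in auto)
  also have "\<dots> = ?v"
    using M.add.finprod_singleton_swap[OF coset_in_rcosets[OF \<alpha>] finite_rcosets, of "\<lambda>_. ?v"] v by simp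
  finally show ?thesis .
qed

text \<open>The decomposition in \<open>L\<close> is projected, and the summands of each coset of degrees are collected.\<close>
lemma quotient_decomposition:
  assumes x: "x \<in> carrier A"
  shows "\<exists>f. f \<in> (\<Pi>\<^sub>E C \<in> rcosets\<^bsub>Q\<^esub> P. E C) \<and> x = finsum A f (rcosets\<^bsub>Q\<^esub> P)"
proof -
  obtain l where l: "l \<in> carrier L" "x = \<pi> l" using x surj by blast
  define f where "f = (\<lambda>C. finsum A (\<lambda>\<alpha>. \<pi> (component \<alpha> l)) C)"
  have in_C: "\<alpha> \<in> carrier Q \<and> P #>\<^bsub>Q\<^esub> \<alpha> = C" if C: "C \<in> rcosets\<^bsub>Q\<^esub> P" "\<alpha> \<in> C" for C \<alpha>
  proof -
    obtain \<beta> where \<beta>: "\<beta> \<in> carrier Q" "C = P #>\<^bsub>Q\<^esub> \<beta>" using C by (auto simp: RCOSETS_def)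
    then show ?thesis
      using C(2) Q.repr_independence[OF _ \<beta>(1) subgroup_P]
        Q.r_coset_subset_G[OF subgroup.subset[OF subgroup_P] \<beta>(1)] by blast
  qed
  have fE: "f C \<in> E C" if C: "C \<in> rcosets\<^bsub>Q\<^esub> P" for C
    unfolding f_def
  proof (rule A.submodule_finsum_closed[OF submodule_E[OF C]])
    fix \<alpha> assume "\<alpha> \<in> C"
    then have "\<alpha> \<in> carrier Q" "P #>\<^bsub>Q\<^esub> \<alpha> = C" using in_C[OF C] by auto
    then show "\<pi> (component \<alpha> l) \<in> E C" using E_coset[of \<alpha>] component_in_D[OF l(1)] by auto
  qed
  have union: "\<Union>(rcosets\<^bsub>Q\<^esub> P) = carrier Q" by (rule Q.rcosets_part_G[OF subgroup_P])
  have "finsum A (\<lambda>\<alpha>. \<pi> (component \<alpha> l)) (\<Union>(rcosets\<^bsub>Q\<^esub> P)) = finsum A f (rcosets\<^bsub>Q\<^esub> P)"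
  proof -
    have "finsum A (\<lambda>\<alpha>. \<pi> (component \<alpha> l)) (\<Union>((\<lambda>C. C) ` (rcosets\<^bsub>Q\<^esub> P))) = finsum A f (rcosets\<^bsub>Q\<^esub> P)"
      unfolding f_def
    proof (rule A.M.add.finprod_UN_disjoint[OF finite_rcosets])
      show "finite C" if "C \<in> rcosets\<^bsub>Q\<^esub> P" for C
        using in_C[OF that] finite_Q by (meson finite_subset subsetI)
      show "pairwise (\<lambda>i. disjnt i) (rcosets\<^bsub>Q\<^esub> P)" by (rule Q.rcos_disjoint[OF subgroup_P])
      show "\<pi> (component \<alpha> l) \<in> carrier A" if "C \<in> rcosets\<^bsub>Q\<^esub> P" "\<alpha> \<in> C" for C \<alpha>
        using in_C[OF that] l by simp
    qed
    then show ?thesis by simp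
  qed
  moreover have "x = finsum A (\<lambda>\<alpha>. \<pi> (component \<alpha> l)) (carrier Q)"
    using \<pi>_finsum[of "carrier Q" "\<lambda>\<alpha>. component \<alpha> l"] l finsum_components by simp
  ultimately have "x = finsum A f (rcosets\<^bsub>Q\<^esub> P)" using union by simp
  also have "\<dots> = finsum A (restrict f (rcosets\<^bsub>Q\<^esub> P)) (rcosets\<^bsub>Q\<^esub> P)"
    using fE A.submoduleE(1)[OF submodule_E] by (intro A.M.finsum_cong') auto
  finally show ?thesis
    using fE by (intro exI[of _ "restrict f (rcosets\<^bsub>Q\<^esub> P)"]) simp
qed

text \<open>Both decompositions are lifted to \<open>L\<close>, using the same representative of each coset. The difference
  of the lifts lies in \<open>I\<close> and has its support in a transversal of \<open>P\<close>, so it is zero.\<close>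
lemma quotient_decomposition_unique:
  assumes f: "f \<in> (\<Pi>\<^sub>E C \<in> rcosets\<^bsub>Q\<^esub> P. E C)" and g: "g \<in> (\<Pi>\<^sub>E C \<in> rcosets\<^bsub>Q\<^esub> P. E C)"
    and eq: "finsum A f (rcosets\<^bsub>Q\<^esub> P) = finsum A g (rcosets\<^bsub>Q\<^esub> P)"
  shows "f = g"
proof -
  have lift: "\<exists>t. (\<forall>C \<in> rcosets\<^bsub>Q\<^esub> P. t C \<in> D (SOME \<alpha>. \<alpha> \<in> C) \<and> h C = \<pi> (t C))"
    if "h \<in> (\<Pi>\<^sub>E C \<in> rcosets\<^bsub>Q\<^esub> P. E C)" for h
    using that by (intro bchoice) (auto simp: E_def image_iff)
  obtain s t where s: "\<And>C. C \<in> rcosets\<^bsub>Q\<^esub> P \<Longrightarrow> s C \<in> D (SOME \<alpha>. \<alpha> \<in> C)"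
      "\<And>C. C \<in> rcosets\<^bsub>Q\<^esub> P \<Longrightarrow> f C = \<pi> (s C)"
    and t: "\<And>C. C \<in> rcosets\<^bsub>Q\<^esub> P \<Longrightarrow> t C \<in> D (SOME \<alpha>. \<alpha> \<in> C)"
      "\<And>C. C \<in> rcosets\<^bsub>Q\<^esub> P \<Longrightarrow> g C = \<pi> (t C)"
    using lift[OF f] lift[OF g] by blast
  have L: "s C \<in> carrier L" "t C \<in> carrier L" if "C \<in> rcosets\<^bsub>Q\<^esub> P" for C
    using s(1)[OF that] t(1)[OF that] coset_representative(1)[OF that] D_closed by blast+
  define x y where "x = finsum L s (rcosets\<^bsub>Q\<^esub> P)" and "y = finsum L t (rcosets\<^bsub>Q\<^esub> P)"
  have xy: "x \<in> carrier L" "y \<in> carrier L" using L by (auto simp: x_def y_def intro!: M.finsum_closed)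
  have "\<pi> x = finsum A f (rcosets\<^bsub>Q\<^esub> P)"
    unfolding x_def using L s(2) by (subst \<pi>_finsum) (auto intro!: A.M.finsum_cong')
  moreover have "\<pi> y = finsum A g (rcosets\<^bsub>Q\<^esub> P)"
    unfolding y_def using L t(2) by (subst \<pi>_finsum) (auto intro!: A.M.finsum_cong')
  ultimately have in_I: "x \<ominus>\<^bsub>L\<^esub> y \<in> I" using eq \<pi>_eq_iff[OF xy] by simp
  have comp: "component \<alpha> (x \<ominus>\<^bsub>L\<^esub> y) =
      (if \<alpha> = (SOME \<beta>. \<beta> \<in> P #>\<^bsub>Q\<^esub> \<alpha>) then s (P #>\<^bsub>Q\<^esub> \<alpha>) \<ominus>\<^bsub>L\<^esub> t (P #>\<^bsub>Q\<^esub> \<alpha>) else \<zero>\<^bsub>L\<^esub>)"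
    if \<alpha>: "\<alpha> \<in> carrier Q" for \<alpha>
    using component_finsum_transversal[of s, OF s(1) \<alpha>] component_finsum_transversal[of t, OF t(1) \<alpha>]
      component_minus[OF xy \<alpha>] by (auto simp: x_def y_def diff_eq_zero_iff)
  have "x \<ominus>\<^bsub>L\<^esub> y = \<zero>\<^bsub>L\<^esub>"
  proof (rule support_in_transversal_imp_zero[OF in_I])
    fix \<alpha> \<beta> assume "\<alpha> \<in> carrier Q" "\<beta> \<in> carrier Q" "\<alpha> \<noteq> \<beta>"
      "component \<alpha> (x \<ominus>\<^bsub>L\<^esub> y) \<noteq> \<zero>\<^bsub>L\<^esub>" "component \<beta> (x \<ominus>\<^bsub>L\<^esub> y) \<noteq> \<zero>\<^bsub>L\<^esub>"
    then show "P #>\<^bsub>Q\<^esub> \<alpha> \<noteq> P #>\<^bsub>Q\<^esub> \<beta>" using comp by metis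
  qed
  then have "component (SOME \<alpha>. \<alpha> \<in> C) (x \<ominus>\<^bsub>L\<^esub> y) = \<zero>\<^bsub>L\<^esub>" if "C \<in> rcosets\<^bsub>Q\<^esub> P" for C
    using component_zero coset_representative(1)[OF that] by simp
  moreover have "component (SOME \<alpha>. \<alpha> \<in> C) (x \<ominus>\<^bsub>L\<^esub> y) = s C \<ominus>\<^bsub>L\<^esub> t C" if "C \<in> rcosets\<^bsub>Q\<^esub> P" for C
    using comp[OF coset_representative(1)[OF that]] coset_representative(2)[OF that] by simp
  ultimately have "s C = t C" if "C \<in> rcosets\<^bsub>Q\<^esub> P" for C
    using that L[OF that] by (metis diff_eq_zero_iff)
  then have "f C = g C" if "C \<in> rcosets\<^bsub>Q\<^esub> P" for C using s(2) t(2) that by simp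
  then show ?thesis using f g by (intro PiE_ext)
qed

lemma graded_lie_algebra_quotient: "graded_lie_algebra K (Q Mod P) A E"
  unfolding graded_lie_algebra_def
proof (intro conjI ballI)
  have carrier: "carrier (Q Mod P) = rcosets\<^bsub>Q\<^esub> P" by (simp add: FactGroup_def)
  show "comm_group (Q Mod P)" by (rule Q.abelian_FactGroup[OF subgroup_P])
  show "lie_algebra K A" by (rule A.lie_algebra_axioms)
  have "finite (carrier (Q Mod P))" using finite_rcosets carrier by simp
  moreover have "\<exists>!f. f \<in> (\<Pi>\<^sub>E C \<in> rcosets\<^bsub>Q\<^esub> P. E C) \<and> x = finsum A f (rcosets\<^bsub>Q\<^esub> P)" if "x \<in> carrier A" for x
    using quotient_decomposition[OF that] quotient_decomposition_unique by blast
  ultimately show "internal_direct_sum K A (carrier (Q Mod P)) E (carrier A)"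
    using A.carrier_is_submodule submodule_E A.submoduleE(1)[OF submodule_E]
    by (simp add: A.internal_direct_sum_finite carrier)
  fix C C' x y assume C: "C \<in> carrier (Q Mod P)" "C' \<in> carrier (Q Mod P)" and xy: "x \<in> E C" "y \<in> E C'"
  obtain \<alpha> \<beta> where \<alpha>\<beta>: "\<alpha> \<in> carrier Q" "\<beta> \<in> carrier Q" "C = P #>\<^bsub>Q\<^esub> \<alpha>" "C' = P #>\<^bsub>Q\<^esub> \<beta>"
    using C carrier by (auto simp: RCOSETS_def)
  have "P \<lhd> Q" using Q.normal_iff_subgroup subgroup_P by blast
  then have "C \<otimes>\<^bsub>Q Mod P\<^esub> C' = P #>\<^bsub>Q\<^esub> (\<alpha> \<otimes>\<^bsub>Q\<^esub> \<beta>)"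
    using \<alpha>\<beta> by (simp add: FactGroup_def normal.rcos_sum)
  then have E: "E (C \<otimes>\<^bsub>Q Mod P\<^esub> C') = \<pi> ` D (\<alpha> \<otimes>\<^bsub>Q\<^esub> \<beta>)" using \<alpha>\<beta> E_coset by simp
  obtain u v where uv: "u \<in> D \<alpha>" "v \<in> D \<beta>" "x = \<pi> u" "y = \<pi> v" using xy \<alpha>\<beta> E_coset by auto
  then have "bracket A x y = \<pi> (bracket L u v)" using \<alpha>\<beta> D_closed by (simp add: \<pi>_bracket)
  then show "bracket A x y \<in> E (C \<otimes>\<^bsub>Q Mod P\<^esub> C')" using E D_bracket[OF \<alpha>\<beta>(1,2) uv(1,2)] by simp
qed

section \<open>The isomorphism with the loop algebra\<close>

definition loop_map :: "'a \<Rightarrow> 'q \<Rightarrow> 'b" where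
  "loop_map x = (\<lambda>\<gamma> \<in> carrier Q. \<pi> (component \<gamma> x))"

text \<open>The finite support condition of the tensor product is automatic because \<open>Q\<close> is finite.\<close>
lemma carrier_loop_algebra:
  "carrier (loop_algebra Q P A E) = {f \<in> extensional (carrier Q). \<forall>\<alpha> \<in> carrier Q. f \<alpha> \<in> \<pi> ` D \<alpha>}"
proof -
  have "f \<alpha> \<in> carrier A" if "\<forall>\<alpha> \<in> carrier Q. f \<alpha> \<in> \<pi> ` D \<alpha>" "\<alpha> \<in> carrier Q" for f :: "'q \<Rightarrow> 'b" and \<alpha>
    using that D_closed[OF that(2)] by fastforce
  then show ?thesis
    using finite_Q
    by (auto simp: loop_algebra_def tensor_group_algebra_def coeff_support_def E_coset PiE_def Pi_def)
qed

text \<open>The bracket of the loop algebra sums over the pairs in the supports with product \<open>\<gamma>\<close>; these are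
  among the pairs \<open>(\<alpha>, \<alpha>\<^sup>-\<^sup>1 \<gamma>)\<close> that \<open>component_bracket\<close> runs over, and the others contribute zero.\<close>
lemma loop_map_bracket:
  assumes x: "x \<in> carrier L" and y: "y \<in> carrier L"
  shows "loop_map (bracket L x y) = bracket (loop_algebra Q P A E) (loop_map x) (loop_map y)"
proof
  fix \<gamma>
  show "loop_map (bracket L x y) \<gamma> = bracket (loop_algebra Q P A E) (loop_map x) (loop_map y) \<gamma>"
  proof (cases "\<gamma> \<in> carrier Q")
    case False
    then show ?thesis by (simp add: loop_map_def loop_algebra_def tensor_group_algebra_def)
  next
    case \<gamma>: True
    let ?S = "\<lambda>z. coeff_support A (carrier Q) (loop_map z)"
    let ?pair = "\<lambda>\<alpha>. (\<alpha>, inv\<^bsub>Q\<^esub> \<alpha> \<otimes>\<^bsub>Q\<^esub> \<gamma>)"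
    let ?b = "\<lambda>(\<alpha>, \<beta>). bracket A (loop_map x \<alpha>) (loop_map y \<beta>)"
    have map_closed: "loop_map z \<alpha> \<in> carrier A" if "z \<in> carrier L" "\<alpha> \<in> carrier Q" for z \<alpha>
      using that by (simp add: loop_map_def)
    have inj: "inj_on ?pair (carrier Q)" by (simp add: inj_on_def)
    have closed: "?b \<in> ?pair ` carrier Q \<rightarrow> carrier A"
      using \<gamma> x y map_closed by (auto intro!: A.bracket_closed)
    have "loop_map (bracket L x y) \<gamma> = \<pi> (component \<gamma> (bracket L x y))"
      using \<gamma> by (simp add: loop_map_def)
    also have "\<dots> = finsum A (\<lambda>\<alpha>. \<pi> (bracket L (component \<alpha> x) (component (inv\<^bsub>Q\<^esub> \<alpha> \<otimes>\<^bsub>Q\<^esub> \<gamma>) y))) (carrier Q)"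
      using x y \<gamma> by (simp add: component_bracket \<pi>_finsum bracket_closed)
    also have "\<dots> = finsum A (\<lambda>\<alpha>. ?b (?pair \<alpha>)) (carrier Q)"
      using x y \<gamma> by (intro A.M.finsum_cong') (auto simp: \<pi>_bracket loop_map_def A.bracket_closed)
    also have "\<dots> = finsum A ?b (?pair ` carrier Q)"
      using A.M.finsum_reindex[OF closed inj] by simp
    also have "\<dots> = finsum A ?b {(\<alpha>, \<beta>). \<alpha> \<in> ?S x \<and> \<beta> \<in> ?S y \<and> \<alpha> \<otimes>\<^bsub>Q\<^esub> \<beta> = \<gamma>}"
    proof (rule A.M.add.finprod_mono_neutral_cong_right[OF _ _ _ _ closed])
      show "finite (?pair ` carrier Q)" using finite_Q by simp
      show "{(\<alpha>, \<beta>). \<alpha> \<in> ?S x \<and> \<beta> \<in> ?S y \<and> \<alpha> \<otimes>\<^bsub>Q\<^esub> \<beta> = \<gamma>} \<subseteq> ?pair ` carrier Q"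
        by (auto simp: coeff_support_def image_iff simp flip: Q.m_assoc)
      fix q assume q: "q \<in> ?pair ` carrier Q - {(\<alpha>, \<beta>). \<alpha> \<in> ?S x \<and> \<beta> \<in> ?S y \<and> \<alpha> \<otimes>\<^bsub>Q\<^esub> \<beta> = \<gamma>}"
      then obtain \<alpha> where \<alpha>: "\<alpha> \<in> carrier Q" "q = ?pair \<alpha>" by blast
      then have "\<alpha> \<otimes>\<^bsub>Q\<^esub> (inv\<^bsub>Q\<^esub> \<alpha> \<otimes>\<^bsub>Q\<^esub> \<gamma>) = \<gamma>" using \<gamma> by (simp flip: Q.m_assoc)
      then have "loop_map x \<alpha> = \<zero>\<^bsub>A\<^esub> \<or> loop_map y (inv\<^bsub>Q\<^esub> \<alpha> \<otimes>\<^bsub>Q\<^esub> \<gamma>) = \<zero>\<^bsub>A\<^esub>"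
        using q \<alpha> \<gamma> by (auto simp: coeff_support_def)
      then show "?b q = \<zero>\<^bsub>A\<^esub>"
        using \<alpha> \<gamma> x y map_closed by (auto simp: A.bracket_zero)
    qed simp
    also have "\<dots> = bracket (loop_algebra Q P A E) (loop_map x) (loop_map y) \<gamma>"
      using \<gamma> by (simp add: loop_algebra_def tensor_group_algebra_def)
    finally show ?thesis .
  qed
qed

lemma loop_map_iso:
  "loop_map \<in> graded_lie_iso K Q L D (loop_algebra Q P A E) (loop_component Q P A E)"
proof -
  have bij: "bij_betw loop_map (carrier L) (carrier (loop_algebra Q P A E))"
  proof (rule bij_betwI')
    show "loop_map x = loop_map y \<longleftrightarrow> x = y" if x: "x \<in> carrier L" and y: "y \<in> carrier L" for x y
    proof
      assume eq: "loop_map x = loop_map y"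
      show "x = y"
      proof (rule component_eqI[OF x y])
        fix \<alpha> assume \<alpha>: "\<alpha> \<in> carrier Q"
        have "\<pi> (component \<alpha> x) = \<pi> (component \<alpha> y)" using fun_cong[OF eq, of \<alpha>] \<alpha> by (simp add: loop_map_def)
        then show "component \<alpha> x = component \<alpha> y"
          using inj_onD[OF inj_on_D[OF \<alpha>]] component_in_D x y \<alpha> by blast
      qed
    qed simp
    show "loop_map x \<in> carrier (loop_algebra Q P A E)" if "x \<in> carrier L" for x
      using that component_in_D by (auto simp: carrier_loop_algebra loop_map_def)
    show "\<exists>x \<in> carrier L. f = loop_map x" if f: "f \<in> carrier (loop_algebra Q P A E)" for f
    proof -
      have "\<forall>\<alpha> \<in> carrier Q. \<exists>x. x \<in> D \<alpha> \<and> f \<alpha> = \<pi> x" using f by (auto simp: carrier_loop_algebra)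
      then obtain h where h: "\<forall>\<alpha> \<in> carrier Q. h \<alpha> \<in> D \<alpha> \<and> f \<alpha> = \<pi> (h \<alpha>)" by metis
      have hL: "finsum L h (carrier Q) \<in> carrier L" using h D_closed by (intro M.finsum_closed) auto
      have "component \<alpha> (finsum L h (carrier Q)) = h \<alpha>" if "\<alpha> \<in> carrier Q" for \<alpha>
        using h that by (intro component_unique) auto
      then have "f = loop_map (finsum L h (carrier Q))"
        using f h by (intro extensionalityI[of _ "carrier Q"]) (auto simp: carrier_loop_algebra loop_map_def)
      then show ?thesis using hL by blast
    qed
  qed
  have add: "loop_map (x \<oplus>\<^bsub>L\<^esub> y) = loop_map x \<oplus>\<^bsub>loop_algebra Q P A E\<^esub> loop_map y"
    if "x \<in> carrier L" "y \<in> carrier L" for x y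
    using that by (auto simp: loop_map_def loop_algebra_def tensor_group_algebra_def component_add \<pi>_add)
  have smult: "loop_map (c \<odot>\<^bsub>L\<^esub> x) = c \<odot>\<^bsub>loop_algebra Q P A E\<^esub> loop_map x"
    if "c \<in> carrier K" "x \<in> carrier L" for c x
    using that by (auto simp: loop_map_def loop_algebra_def tensor_group_algebra_def component_smult \<pi>_smult)
  have components: "loop_map ` D \<alpha> = loop_component Q P A E \<alpha>" if \<alpha>: "\<alpha> \<in> carrier Q" for \<alpha>
  proof -
    have "loop_map x = tensor_monomial Q A (\<pi> x) \<alpha>" if "x \<in> D \<alpha>" for x
      using component_homogeneous[OF that \<alpha>] by (auto simp: loop_map_def tensor_monomial_def)
    then show ?thesis unfolding loop_component_def E_coset[OF \<alpha>] image_image by (intro image_cong) auto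
  qed
  show ?thesis
    unfolding graded_lie_iso_def using bij add smult loop_map_bracket components by blast
qed

end

section \<open>Graded simple Lie algebras as loop algebras\<close>

theorem corollary12:
  fixes K :: "('k, 'n) ring_scheme"
    and Q :: "('q, 'p) monoid_scheme"
    and L :: "('k, 'a, 'm) lie_algebra_scheme"
    and D :: "'q \<Rightarrow> 'a set"
  assumes "field K"
    and "comm_group Q" "finite (carrier Q)"
    and "\<exists>\<zeta> \<in> carrier (Multiplicative_Group.mult_of K). group.ord (Multiplicative_Group.mult_of K) \<zeta> = order Q"
    and "graded_simple K Q L D"
    and "minimal_grading Q L D"
  shows "\<exists>P (A :: ('k, 'a) lie_algebra) E.
    subgroup P Q \<and>
    simple_lie_algebra K A \<and>
    graded_lie_algebra K (Q Mod P) A E \<and>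
    graded_lie_iso K Q L D (loop_algebra Q P A E) (loop_component Q P A E) \<noteq> {}"
proof -
  interpret field K by fact
  have graded: "graded_lie_algebra K Q L D" using assms(5) by (simp add: graded_simple_def)
  then have L: "lie_algebra K L" by (simp add: graded_lie_algebra_def)
  have mult_group: "comm_group (Multiplicative_Group.mult_of K)"
    using field_mult_group m_comm by (intro group.group_comm_groupI) auto
  obtain \<zeta> where \<zeta>: "\<zeta> \<in> carrier (Multiplicative_Group.mult_of K)"
      "group.ord (Multiplicative_Group.mult_of K) \<zeta> = order Q"
    using assms(4) by (rule bexE)
  obtain \<Xi> where \<Xi>: "separating_character_group Q (Multiplicative_Group.mult_of K) \<Xi>"
    using exists_separating_character_group[OF assms(2,3) mult_group \<zeta>] by (rule exE)
  interpret simple: finite_graded_simple_lie_algebra K L Q D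
    by (intro finite_graded_simple_lie_algebra.intro finite_graded_lie_algebra.intro
      finite_graded_lie_algebra_axioms.intro finite_graded_simple_lie_algebra_axioms.intro L assms graded)
  obtain I where I: "maximal_lie_ideal I K L" using simple.exists_maximal_lie_ideal by blast
  obtain A :: "('k, 'a) lie_algebra" and \<pi>
    where \<pi>: "lie_epimorphism K L A \<pi>" and kernel: "{x \<in> carrier L. \<pi> x = \<zero>\<^bsub>A\<^esub>} = I"
    using simple.exists_quotient_lie_algebra[of I] I by (auto simp: maximal_lie_ideal_def)
  interpret quotient: graded_simple_quotient K L Q D \<Xi> I A \<pi>
    by (intro graded_simple_quotient.intro graded_simple_with_maximal_ideal.intro
      graded_simple_with_maximal_ideal_axioms.intro graded_simple_quotient_axioms.intro
      simple.finite_graded_simple_lie_algebra_axioms \<Xi> I \<pi> kernel)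
  have "simple_lie_algebra K A"
    using quotient.simple_lie_algebra_quotient[OF simple.perfect] I kernel by simp
  moreover have "graded_lie_iso K Q L D (loop_algebra Q quotient.P A quotient.E)
      (loop_component Q quotient.P A quotient.E) \<noteq> {}"
    using quotient.loop_map_iso by (rule ex_in_conv[THEN iffD1, OF exI])
  ultimately show ?thesis
    using quotient.subgroup_P quotient.graded_lie_algebra_quotient by (intro exI conjI)
qed

end
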